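(* Let $\{X_t,\ t\in\mathbb{Z}\}$ be a strictly stationary zero-mean functional time series with values in a real separable Hilbert space $H$, with $E\|X_0\|_H^2<\infty$, and with spectral density operators $\mathcal{F}_\omega$ on $\widetilde{H}=H+iH$ given by $\mathcal{F}_\omega=\frac{1}{2\pi}\sum_{t\in\mathbb{Z}}\exp(-i\omega t)\mathcal{R}_t$ (convergence in $\mathcal{L}(\widetilde{H})$ for $\omega\in[-\pi,\pi]\setminus\{0\}$). Assume that $$\int_{-\pi}^{\pi}\|\mathcal{F}_\omega\|_{\mathcal{L}(\widetilde{H})}\,d\omega<\infty.$$ Then, with $\mathcal{F}_\omega^{(T)}=E[p_\omega^{(T)}]$ the mean of the periodogram operator based on $X_1,\dots,X_T$, $$\left\|\int_{-\pi}^{\pi}\left[\mathcal{F}_\omega-\mathcal{F}_\omega^{(T)}\right]d\omega\right\|_{\mathcal{S}(\widetilde{H})}\to0,\qquad T\to\infty.$$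
   Context: $\widetilde{H}=H+iH$ is the complexification of $H$, with inner product $\langle\varphi_1+i\varphi_2,\phi_1+i\phi_2\rangle_{\widetilde{H}}=\langle\varphi_1,\phi_1\rangle_H+\langle\varphi_2,\phi_2\rangle_H+i(\langle\varphi_2,\phi_1\rangle_H-\langle\varphi_1,\phi_2\rangle_H)$. $\|\cdot\|_{\mathcal{L}(\widetilde{H})}$ is the operator norm and $\|\cdot\|_{\mathcal{S}(\widetilde{H})}$ the Hilbert--Schmidt norm. The covariance operators are $\mathcal{R}_t=E[X_{s+t}\otimes X_s]$, i.e. $\mathcal{R}_t(g)(h)=E[\langle X_{s+t},h\rangle_H\langle X_s,g\rangle_H]$ for $g,h\in H$ and $s,t\in\mathbb{Z}$, extended to $\widetilde{H}$. The functional discrete Fourier transform is $\widetilde{X}_\omega^{(T)}=\frac{1}{\sqrt{2\pi T}}\sum_{t=1}^{T}X_t\exp(-i\omega t)$, $\omega\in[-\pi,\pi]$; the periodogram operator is $p_\omega^{(T)}=\widetilde{X}_\omega^{(T)}\otimes\overline{\widetilde{X}_\omega^{(T)}}$; and its mean is $$\mathcal{F}_\omega^{(T)}=E[p_\omega^{(T)}]=\frac{1}{2\pi}\sum_{u=-(T-1)}^{T-1}\exp(-i\omega u)\frac{T-|u|}{T}\mathcal{R}_u.$$ *)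

theory Defs
  imports "HOL-Probability.Probability"
begin

text \<open>
  The complexification of a real Hilbert space \<open>H\<close> is carried by \<open>H \<times> H\<close>, the pair \<open>(a, b)\<close>
  standing for \<open>a + i b\<close>. The product norm of the library is the norm of the complex inner product
  \<open>cinner\<close> below, so that the library norm on \<open>(H \<times> H) \<Rightarrow>\<^sub>L (H \<times> H)\<close> is the operator norm. That
  type consists of the real-linear bounded operators; the complex-linear ones form a closed subspace
  of it, which contains all the operators constructed here, with the same norm.
\<close>

type_synonym 'h cplx = "'h \<times> 'h"
type_synonym 'h cop = "'h cplx \<Rightarrow>\<^sub>L 'h cplx"

definition emb :: "'h::real_normed_vector \<Rightarrow> 'h cplx" where
  "emb x = (x, 0)"

definition cscale :: "complex \<Rightarrow> 'h::real_normed_vector cplx \<Rightarrow> 'h cplx" where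
  "cscale c z = (Re c *\<^sub>R fst z - Im c *\<^sub>R snd z, Re c *\<^sub>R snd z + Im c *\<^sub>R fst z)"

definition conjugate :: "'h::real_normed_vector cplx \<Rightarrow> 'h cplx" where
  "conjugate z = (fst z, - snd z)"

definition cinner :: "'h::real_inner cplx \<Rightarrow> 'h cplx \<Rightarrow> complex" where
  "cinner x y = Complex (inner (fst x) (fst y) + inner (snd x) (snd y))
                        (inner (snd x) (fst y) - inner (fst x) (snd y))"

lemma cinner_self: "cinner z z = complex_of_real ((norm z)\<^sup>2)"
  by (simp add: cinner_def complex_eq_iff power2_norm_eq_inner inner_prod_def inner_commute)

lemma norm_cscale: "norm (cscale c z) = cmod c * norm (z :: 'h::real_inner cplx)"
proof -
  have "(norm (cscale c z))\<^sup>2 = ((Re c)\<^sup>2 + (Im c)\<^sup>2) * (norm z)\<^sup>2"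
    unfolding power2_norm_eq_inner cscale_def inner_prod_def
    by (simp add: inner_simps inner_commute[of "snd z" "fst z"] algebra_simps power2_eq_square)
  then have "(norm (cscale c z))\<^sup>2 = (cmod c * norm z)\<^sup>2"
    by (simp add: power_mult_distrib cmod_power2)
  then show ?thesis
    by (metis norm_ge_zero mult_nonneg_nonneg power2_eq_iff_nonneg)
qed

lemma bounded_linear_cscale: "bounded_linear (cscale c :: 'h::real_inner cplx \<Rightarrow> 'h cplx)"
proof (rule bounded_linear_intro)
  fix z :: "'h cplx"
  show "norm (cscale c z) \<le> norm z * cmod c"
    by (simp add: norm_cscale mult.commute)
qed (simp_all add: cscale_def algebra_simps)

definition cscale_op :: "complex \<Rightarrow> 'h::real_inner cop \<Rightarrow> 'h cop" where
  "cscale_op c A = Blinfun (\<lambda>z. cscale c (blinfun_apply A z))"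

lemma cscale_op_apply [simp]: "blinfun_apply (cscale_op c A) z = cscale c (blinfun_apply A z)"
  unfolding cscale_op_def
  by (subst bounded_linear_Blinfun_apply)
    (auto intro: bounded_linear_compose[OF bounded_linear_cscale blinfun.bounded_linear_right])

text \<open>The complex-linear extension \<open>a + i b \<mapsto> A a + i A b\<close> of an operator on \<open>H\<close>.\<close>

definition complexify :: "('h::real_inner \<Rightarrow>\<^sub>L 'h) \<Rightarrow> 'h cop" where
  "complexify A = Blinfun (\<lambda>z. (blinfun_apply A (fst z), blinfun_apply A (snd z)))"

lemma complexify_apply [simp]:
  "blinfun_apply (complexify A) z = (blinfun_apply A (fst z), blinfun_apply A (snd z))"
  unfolding complexify_def
  by (subst bounded_linear_Blinfun_apply)
    (auto intro!: bounded_linear_Pair bounded_linear_compose[OF blinfun.bounded_linear_right]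
      bounded_linear_fst bounded_linear_snd)

text \<open>
  The tensor product is bilinear: for \<open>x, y \<in> H\<close> and \<open>g \<in> H\<close> it is \<open>(x \<otimes> y) g = \<langle>y, g\<rangle> x\<close>, the
  convention of the covariance operators, and the formula below is the extension that is complex
  linear in \<open>x\<close>, \<open>y\<close> and the argument. In particular \<open>(x \<otimes> conjugate x) z = \<langle>z, x\<rangle> x\<close>.
\<close>

definition tensor :: "'h::real_inner cplx \<Rightarrow> 'h cplx \<Rightarrow> 'h cop" where
  "tensor x y = Blinfun (\<lambda>z. cscale (cinner z (conjugate y)) x)"

lemma tensor_apply [simp]: "blinfun_apply (tensor x y) z = cscale (cinner z (conjugate y)) x"
proof -
  have "bounded_linear (\<lambda>z. cscale (cinner z (conjugate y)) x)"
    unfolding cscale_def cinner_def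
    by (auto intro!: bounded_linear_Pair bounded_linear_add bounded_linear_sub
        bounded_linear_scaleR_const bounded_linear_inner_left_comp bounded_linear_fst
        bounded_linear_snd)
  then show ?thesis
    by (simp add: tensor_def bounded_linear_Blinfun_apply)
qed

text \<open>
  Expectation of a random operator. The space of bounded operators is not second countable, which
  the library's Bochner integral requires, so the expectation is taken pointwise:
  \<open>E[P] z = E[P z]\<close>, a Bochner integral in the complexification.
\<close>

definition op_expectation ::
  "'w measure \<Rightarrow> ('w \<Rightarrow> 'h::{real_inner,banach,second_countable_topology} cop) \<Rightarrow> 'h cop" where
  "op_expectation M P = Blinfun (\<lambda>z. \<integral>w. blinfun_apply (P w) z \<partial>M)"

lemma op_expectation_apply:
  fixes P :: "'w \<Rightarrow> 'h::{real_inner,banach,second_countable_topology} cop"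
  assumes meas: "\<And>z. (\<lambda>w. blinfun_apply (P w) z) \<in> borel_measurable M"
    and bound: "integrable M B" "\<And>w. norm (P w) \<le> B w"
  shows "blinfun_apply (op_expectation M P) z = (\<integral>w. blinfun_apply (P w) z \<partial>M)"
proof -
  have le: "norm (blinfun_apply (P w) z) \<le> B w * norm z" for w z
    using norm_blinfun[of "P w" z] bound(2)[of w] by (meson mult_right_mono norm_ge_zero order_trans)
  have int: "integrable M (\<lambda>w. blinfun_apply (P w) z)" for z
  proof (rule Bochner_Integration.integrable_bound[OF _ meas])
    show "integrable M (\<lambda>w. B w * norm z)" using bound(1) by simp
    show "AE w in M. norm (blinfun_apply (P w) z) \<le> norm (B w * norm z)"
      using le[of _ z] by (auto intro!: AE_I2 intro: order_trans[OF _ abs_ge_self])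
  qed
  have "bounded_linear (\<lambda>z. \<integral>w. blinfun_apply (P w) z \<partial>M)"
  proof (rule bounded_linear_intro)
    fix z :: "'h cplx"
    have "norm (\<integral>w. blinfun_apply (P w) z \<partial>M) \<le> (\<integral>w. norm (blinfun_apply (P w) z) \<partial>M)"
      by (rule integral_norm_bound)
    also have "\<dots> \<le> (\<integral>w. B w * norm z \<partial>M)"
      using bound(1) le[of _ z] int by (intro integral_mono) auto
    finally show "norm (\<integral>w. blinfun_apply (P w) z \<partial>M) \<le> norm z * (\<integral>w. B w \<partial>M)"
      by (simp add: mult.commute)
  qed (simp_all add: blinfun.add_right blinfun.scaleR_right Bochner_Integration.integral_add int)
  then show ?thesis
    by (simp add: op_expectation_def bounded_linear_Blinfun_apply)
qed

definition strictly_stationary ::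
  "'w measure \<Rightarrow> (int \<Rightarrow> 'w \<Rightarrow> 'h::topological_space) \<Rightarrow> bool" where
  "strictly_stationary M X \<longleftrightarrow>
     (\<forall>J s. finite J \<longrightarrow>
        distr M (\<Pi>\<^sub>M t\<in>J. borel) (\<lambda>w. \<lambda>t\<in>J. X (t + s) w) =
        distr M (\<Pi>\<^sub>M t\<in>J. borel) (\<lambda>w. \<lambda>t\<in>J. X t w))"

text \<open>
  The covariance operator at lag \<open>t\<close>, \<open>E[X\<^sub>t \<otimes> X\<^sub>0]\<close>; by stationarity the base point \<open>0\<close> is
  immaterial, see \<open>inner_autocov\<close>.
\<close>

definition autocov ::
  "'w measure \<Rightarrow> (int \<Rightarrow> 'w \<Rightarrow> 'h::{real_inner,banach,second_countable_topology}) \<Rightarrow> int \<Rightarrow>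
   ('h \<Rightarrow>\<^sub>L 'h)" where
  "autocov M X t = Blinfun (\<lambda>g. \<integral>w. inner (X 0 w) g *\<^sub>R X t w \<partial>M)"

lemma stationary_integrals:
  fixes X :: "int \<Rightarrow> 'w \<Rightarrow> 'h::{real_inner,banach,second_countable_topology}"
    and f :: "'h \<Rightarrow> 'h \<Rightarrow> real"
  assumes meas: "\<And>t. X t \<in> borel_measurable M"
    and stat: "strictly_stationary M X"
    and f: "(\<lambda>p. f (fst p) (snd p)) \<in> borel_measurable borel"
  shows "integrable M (\<lambda>w. f (X (t + s) w) (X (u + s) w)) \<longleftrightarrow> integrable M (\<lambda>w. f (X t w) (X u w))"
    and "(\<integral>w. f (X (t + s) w) (X (u + s) w) \<partial>M) = (\<integral>w. f (X t w) (X u w) \<partial>M)"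
proof -
  let ?P = "\<Pi>\<^sub>M t\<in>{t,u}. (borel :: 'h measure)"
  let ?F = "\<lambda>y. f (y t) (y u)"
  have pair: "(\<lambda>y. (y t, y u)) \<in> measurable ?P (borel :: ('h \<times> 'h) measure)"
    unfolding borel_prod[symmetric] by measurable
  have F: "?F \<in> borel_measurable ?P"
    using measurable_compose[OF pair f] by simp
  have eq: "distr M ?P (\<lambda>w. \<lambda>v\<in>{t,u}. X (v + s) w) = distr M ?P (\<lambda>w. \<lambda>v\<in>{t,u}. X (v + 0) w)"
    using stat unfolding strictly_stationary_def by simp
  have m0: "(\<lambda>w. \<lambda>v\<in>{t,u}. X (v + a) w) \<in> measurable M ?P" for a
    using meas by (intro measurable_restrict) auto
  show "integrable M (\<lambda>w. f (X (t + s) w) (X (u + s) w)) \<longleftrightarrow> integrable M (\<lambda>w. f (X t w) (X u w))"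
    using integrable_distr_eq[OF m0[of s] F] integrable_distr_eq[OF m0[of 0] F] eq by simp
  show "(\<integral>w. f (X (t + s) w) (X (u + s) w) \<partial>M) = (\<integral>w. f (X t w) (X u w) \<partial>M)"
    using integral_distr[OF m0[of s] F] integral_distr[OF m0[of 0] F] eq by simp
qed

lemma inner_autocov:
  fixes X :: "int \<Rightarrow> 'w \<Rightarrow> 'h::{real_inner,banach,second_countable_topology}"
  assumes meas: "\<And>t. X t \<in> borel_measurable M"
    and stat: "strictly_stationary M X"
    and sq: "integrable M (\<lambda>w. (norm (X 0 w))\<^sup>2)"
  shows "inner (blinfun_apply (autocov M X t) g) h =
    (\<integral>w. inner (X (s + t) w) h * inner (X s w) g \<partial>M)"
proof -
  note [measurable] = meas
  have sq': "integrable M (\<lambda>w. (norm (X t w))\<^sup>2)" for t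
    using stationary_integrals(1)[OF meas stat, of "\<lambda>x y. (norm x)\<^sup>2" 0 t 0] sq
    by (simp add: borel_measurable_continuous_onI continuous_intros)
  let ?B = "\<lambda>w. (norm (X 0 w))\<^sup>2 + (norm (X t w))\<^sup>2"
  have B: "integrable M ?B" using sq' by simp
  have le: "norm (inner (X 0 w) g *\<^sub>R X t w) \<le> ?B w * norm g" for w g
  proof -
    have "norm (inner (X 0 w) g *\<^sub>R X t w) \<le> (norm (X 0 w) * norm (X t w)) * norm g"
      using mult_right_mono[OF Cauchy_Schwarz_ineq2[of "X 0 w" g], of "norm (X t w)"]
      by (simp add: mult_ac)
    also have "norm (X 0 w) * norm (X t w) \<le> ?B w"
      using sum_squares_bound[of "norm (X 0 w)" "norm (X t w)"]
        mult_nonneg_nonneg[OF norm_ge_zero[of "X 0 w"] norm_ge_zero[of "X t w"]] by linarith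
    finally show ?thesis by (simp add: mult_right_mono)
  qed
  have int: "integrable M (\<lambda>w. inner (X 0 w) g *\<^sub>R X t w)" for g
  proof (rule Bochner_Integration.integrable_bound)
    show "integrable M (\<lambda>w. ?B w * norm g)" using B by simp
    show "AE w in M. norm (inner (X 0 w) g *\<^sub>R X t w) \<le> norm (?B w * norm g)"
      using le[of _ g] by (auto intro!: AE_I2 intro: order_trans[OF _ abs_ge_self])
  qed measurable
  have "bounded_linear (\<lambda>g. \<integral>w. inner (X 0 w) g *\<^sub>R X t w \<partial>M)"
  proof (rule bounded_linear_intro)
    fix g :: 'h
    have "norm (\<integral>w. inner (X 0 w) g *\<^sub>R X t w \<partial>M) \<le> (\<integral>w. norm (inner (X 0 w) g *\<^sub>R X t w) \<partial>M)"
      by (rule integral_norm_bound)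
    also have "\<dots> \<le> (\<integral>w. ?B w * norm g \<partial>M)"
      by (rule integral_mono[OF integrable_norm[OF int] integrable_mult_left[OF B] le])
    finally show "norm (\<integral>w. inner (X 0 w) g *\<^sub>R X t w \<partial>M) \<le> norm g * (\<integral>w. ?B w \<partial>M)"
      by (simp add: mult.commute)
  next
    fix g h :: 'h
    show "(\<integral>w. inner (X 0 w) (g + h) *\<^sub>R X t w \<partial>M) =
      (\<integral>w. inner (X 0 w) g *\<^sub>R X t w \<partial>M) + (\<integral>w. inner (X 0 w) h *\<^sub>R X t w \<partial>M)"
      using int by (simp add: inner_add_right scaleR_add_left)
  next
    fix r and g :: 'h
    show "(\<integral>w. inner (X 0 w) (r *\<^sub>R g) *\<^sub>R X t w \<partial>M) = r *\<^sub>R (\<integral>w. inner (X 0 w) g *\<^sub>R X t w \<partial>M)"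
      by (simp flip: scaleR_scaleR)
  qed
  then have "inner (blinfun_apply (autocov M X t) g) h = (\<integral>w. inner (inner (X 0 w) g *\<^sub>R X t w) h \<partial>M)"
    using int by (simp add: autocov_def bounded_linear_Blinfun_apply del: inner_scaleR_left)
  also have "\<dots> = (\<integral>w. inner (X t w) h * inner (X 0 w) g \<partial>M)"
    by (simp add: mult.commute)
  also have "\<dots> = (\<integral>w. inner (X (t + s) w) h * inner (X (0 + s) w) g \<partial>M)"
    by (rule stationary_integrals(2)[OF meas stat, of "\<lambda>x y. inner x h * inner y g", symmetric])
      (intro borel_measurable_continuous_onI continuous_intros)
  finally show ?thesis by (simp add: add.commute)
qed

text \<open>
  The series over the integers is the limit of its symmetric partial sums, in the operator norm.
\<close>

definition is_spectral_density_at ::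
  "'w measure \<Rightarrow> (int \<Rightarrow> 'w \<Rightarrow> 'h::{real_inner,banach,second_countable_topology}) \<Rightarrow> real \<Rightarrow>
   'h cop \<Rightarrow> bool" where
  "is_spectral_density_at M X \<omega> A \<longleftrightarrow>
     (\<lambda>n. (1 / (2 * pi)) *\<^sub>R
        (\<Sum>t\<in>{- int n..int n}.
           cscale_op (exp (- (\<i> * of_real \<omega> * of_int t))) (complexify (autocov M X t))))
     \<longlonglongrightarrow> A"

definition fdft ::
  "(int \<Rightarrow> 'w \<Rightarrow> 'h::real_normed_vector) \<Rightarrow> nat \<Rightarrow> real \<Rightarrow> 'w \<Rightarrow> 'h cplx" where
  "fdft X T \<omega> w =
     (1 / sqrt (2 * pi * real T)) *\<^sub>R
       (\<Sum>t\<in>{1..int T}. cscale (exp (- (\<i> * of_real \<omega> * of_int t))) (emb (X t w)))"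

definition periodogram ::
  "(int \<Rightarrow> 'w \<Rightarrow> 'h::real_inner) \<Rightarrow> nat \<Rightarrow> real \<Rightarrow> 'w \<Rightarrow> 'h cop" where
  "periodogram X T \<omega> w = tensor (fdft X T \<omega> w) (conjugate (fdft X T \<omega> w))"

definition mean_periodogram ::
  "'w measure \<Rightarrow> (int \<Rightarrow> 'w \<Rightarrow> 'h::{real_inner,banach,second_countable_topology}) \<Rightarrow> nat \<Rightarrow> real \<Rightarrow>
   'h cop" where
  "mean_periodogram M X T \<omega> = op_expectation M (periodogram X T \<omega>)"

text \<open>
  A (complex) orthonormal basis; the complex span of \<open>E\<close> is the real span of \<open>E \<union> i E\<close>.
\<close>

definition orthonormal_basis :: "'h::real_inner cplx set \<Rightarrow> bool" where
  "orthonormal_basis E \<longleftrightarrow>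
     (\<forall>x\<in>E. \<forall>y\<in>E. cinner x y = (if x = y then 1 else 0)) \<and>
     closure (span (E \<union> cscale \<i> ` E)) = UNIV"

text \<open>
  Neither notion below depends on the choice of the basis, for complex-linear \<open>A\<close>. The value
  \<open>hs_norm A\<close> is meaningful only if \<open>hilbert_schmidt A\<close>.
\<close>

definition some_basis :: "'h::real_inner cplx set" where
  "some_basis = (SOME E. orthonormal_basis E)"

definition hilbert_schmidt :: "'h::real_inner cop \<Rightarrow> bool" where
  "hilbert_schmidt A \<longleftrightarrow> (\<lambda>e. (norm (blinfun_apply A e))\<^sup>2) summable_on some_basis"

definition hs_norm :: "'h::real_inner cop \<Rightarrow> real" where
  "hs_norm A = sqrt (\<Sum>\<^sub>\<infinity>e\<in>some_basis. (norm (blinfun_apply A e))\<^sup>2)"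

end

theory Submission
  imports Defs
begin

text \<open>
  Both integrals equal the covariance operator \<open>R\<^sub>0\<close>, so their difference is exactly \<open>0\<close> for
  every \<open>T \<ge> 1\<close>. For the mean periodogram this is the orthogonality of the exponentials: it is a
  trigonometric polynomial with constant coefficient \<open>R\<^sub>0 / (2 \<pi>)\<close>. For the spectral density it is
  the assertion that a trigonometric series converging everywhere except at \<open>0\<close> has the coefficient
  dictated by integrating its sum. Convergence is only pointwise, so the sum and the integral cannot
  be exchanged; that the coefficients are a covariance is what saves the argument.

  \<^emph>\<open>Reduction to scalars.\<close> The integral \<open>D\<close> of the difference is self-adjoint, being built
  from self-adjoint operators, so it vanishes as soon as \<open>\<langle>D z, z\<rangle> = 0\<close> for all \<open>z\<close>
  (\<open>symmetric_blinfun_eq_0\<close>). The numbers \<open>c\<^sub>t = \<langle>R\<^sub>t z, z\<rangle>\<close> are positive definite, since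
  their Fejer means are, up to the factor \<open>2 \<pi>\<close>, the expectations of the squared components along
  \<open>z\<close> of the discrete Fourier transform.

  \<^emph>\<open>The scalar theorem\<close> (\<open>positive_trigonometric_series_integral\<close>). By Herglotz' theorem
  \<open>c\<close> is the sequence of Fourier coefficients of a positive measure \<open>\<mu>\<close> on \<open>[-\<pi>, \<pi>]\<close>; normalize
  \<open>c\<^sub>0 = \<mu>(UNIV) = 1\<close>. The Abel means of the series are the Poisson integrals \<open>A\<^sub>r\<close> of \<open>\<mu>\<close>: they are
  nonnegative, have integral \<open>2 \<pi>\<close>, and tend to the sum \<open>f\<close> off \<open>0\<close>. Fatou's lemma gives
  \<open>\<integral>f \<le> 2 \<pi>\<close>, and the question is whether mass escapes to a singular part of \<open>\<mu>\<close>. It does not: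
  the sets \<open>E\<^sub>k\<close> on which all the means \<open>A\<^sub>r\<close> are at most \<open>k\<close> are compact and exhaust
  \<open>[-\<pi>, \<pi>] - {0}\<close>, because convergent sequences are bounded; the part of \<open>\<mu>\<close> on \<open>E\<^sub>k\<close> has Poisson
  integral at most \<open>4 k\<close> \<^emph>\<open>everywhere\<close>, by a maximum principle (\<open>poisson_integral_maximum\<close>); and
  the mass outside \<open>E\<^sub>k\<close> tends to at most \<open>\<mu>{0}\<close>, which is \<open>0\<close> because convergence of the series at \<open>\<pi>\<close>
  forces the real parts of its coefficients to tend to \<open>0\<close>. So the means are, up to a small error in
  mean, bounded by a constant, and the bounded convergence theorem applies.

  \<^emph>\<open>Integrability in operator norm.\<close> In infinite dimensions the space of bounded operators is
  not separable. The density is however a function of integrable norm that is a pointwise limit of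
  operator-valued trigonometric polynomials. Such a function is approximated in mean by continuous
  ones, which makes it integrable in the gauge sense, with measure theory applied to real functions only
  (\<open>pointwise_limit_of_continuous_integrable_on\<close>).
\<close>

section \<open>Abel summation\<close>

text \<open>
  The weights \<open>(1 - r) r\<^sup>n\<close> have total mass \<open>1\<close> and, as \<open>r\<close> tends to \<open>1\<close>, move it out to
  infinity: the first \<open>N\<close> of them, where the sequence is not yet close to its limit, carry at most
  \<open>(1 - r) N\<close>.
\<close>

lemma abel_mean_tendsto:
  fixes u :: "nat \<Rightarrow> real"
  assumes u: "u \<longlonglongrightarrow> L" and r: "\<And>j. 0 \<le> r j" "\<And>j. r j < 1" "r \<longlonglongrightarrow> 1"
  shows "(\<lambda>j. (1 - r j) * (\<Sum>n. r j ^ n * u n)) \<longlonglongrightarrow> L"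
proof -
  obtain B where B: "\<And>n. \<bar>u n - L\<bar> \<le> B"
    using convergent_imp_Bseq[OF convergentI[OF tendsto_diff[OF u tendsto_const[of L]]]]
    by (auto simp: Bseq_def)
  have "(\<lambda>j. (1 - r j) * (\<Sum>n. r j ^ n * (u n - L))) \<longlonglongrightarrow> 0"
  proof (rule LIMSEQ_I)
    fix e :: real assume e: "e > 0"
    obtain N where N: "\<And>n. n \<ge> N \<Longrightarrow> \<bar>u n - L\<bar> < e / 2"
      using LIMSEQ_D[OF u, of "e / 2"] e by auto
    have "(\<lambda>j. (1 - r j) * (real N * B)) \<longlonglongrightarrow> (1 - 1) * (real N * B)"
      by (intro tendsto_intros r)
    then obtain J where J: "\<And>j. j \<ge> J \<Longrightarrow> \<bar>(1 - r j) * (real N * B)\<bar> < e / 2"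
      using LIMSEQ_D[of "\<lambda>j. (1 - r j) * (real N * B)" 0 "e / 2"] e by auto
    show "\<exists>no. \<forall>j\<ge>no. norm ((1 - r j) * (\<Sum>n. r j ^ n * (u n - L)) - 0) < e"
    proof (intro exI[of _ J] allI impI)
      fix j assume j: "j \<ge> J"
      let ?m = "\<lambda>n. (if n < N then B else 0) + r j ^ n * (e / 2)"
      have fin: "(\<lambda>n. if n < N then B else 0) sums (real N * B)"
        using sums_finite[of "{..<N}" "\<lambda>n. if n < N then B else 0"] by simp
      have geo: "(\<lambda>n. r j ^ n) sums (1 / (1 - r j))"
        using geometric_sums[of "r j"] r(1,2)[of j] by simp
      have m: "?m sums (real N * B + 1 / (1 - r j) * (e / 2))"
        by (intro sums_add fin sums_mult2 geo)
      have le: "norm (r j ^ n * (u n - L)) \<le> ?m n" for n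
      proof (cases "n < N")
        case True
        have "r j ^ n * \<bar>u n - L\<bar> \<le> 1 * B"
          using B[of n] r(1,2)[of j] by (intro mult_mono power_le_one) auto
        moreover have "0 \<le> r j ^ n * e" using e r(1)[of j] by simp
        ultimately show ?thesis using True r(1)[of j] by (simp add: abs_mult)
      next
        case False
        then have "\<bar>u n - L\<bar> \<le> e / 2" using N[of n] by simp
        then have "r j ^ n * \<bar>u n - L\<bar> \<le> r j ^ n * (e / 2)"
          by (rule mult_left_mono) (simp add: r)
        then show ?thesis using False r(1)[of j] by (simp add: abs_mult)
      qed
      have "summable (\<lambda>n. r j ^ n * (u n - L))"
        by (rule summable_comparison_test'[OF sums_summable[OF m]]) (rule le)
      then have "\<bar>\<Sum>n. r j ^ n * (u n - L)\<bar> \<le> real N * B + 1 / (1 - r j) * (e / 2)"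
        using norm_sums_le[OF summable_sums m le] by simp
      then have "(1 - r j) * \<bar>\<Sum>n. r j ^ n * (u n - L)\<bar> \<le> (1 - r j) * (real N * B + 1 / (1 - r j) * (e / 2))"
        by (rule mult_left_mono) (use r(2)[of j] in simp)
      also have "\<dots> = (1 - r j) * (real N * B) + e / 2"
        using r(2)[of j] by (simp add: field_simps)
      also have "\<dots> < e" using J[OF j] by linarith
      finally show "norm ((1 - r j) * (\<Sum>n. r j ^ n * (u n - L)) - 0) < e"
        using r(2)[of j] by (simp add: abs_mult)
    qed
  qed
  moreover have "(1 - r j) * (\<Sum>n. r j ^ n * (u n - L)) = (1 - r j) * (\<Sum>n. r j ^ n * u n) - L" for j
  proof -
    have geo: "(\<lambda>n. r j ^ n) sums (1 / (1 - r j))"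
      using geometric_sums[of "r j"] r(1,2)[of j] by simp
    have "summable (\<lambda>n. r j ^ n * (u n - L))"
    proof (rule summable_comparison_test'[OF sums_summable[OF sums_mult2[OF geo, of B]]])
      show "norm (r j ^ n * (u n - L)) \<le> r j ^ n * B" for n
        using B[of n] r(1)[of j] by (simp add: abs_mult mult_left_mono)
    qed
    from sums_add[OF summable_sums[OF this] sums_mult2[OF geo, of L]]
    have "(\<lambda>n. r j ^ n * u n) sums ((\<Sum>n. r j ^ n * (u n - L)) + 1 / (1 - r j) * L)"
      by (simp add: algebra_simps)
    then show ?thesis using r(2)[of j] by (simp add: sums_iff field_simps)
  qed
  ultimately show ?thesis
    using tendsto_add[OF _ tendsto_const[of L], of "\<lambda>j. (1 - r j) * (\<Sum>n. r j ^ n * (u n - L))" 0] by simp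
qed

text \<open>
  Abel's limit theorem. Summation by parts turns the power series into the mean of the previous lemma
  applied to the partial sums.
\<close>

lemma abel_sum_tendsto:
  fixes a :: "nat \<Rightarrow> real"
  assumes a: "a sums L" and r: "\<And>j. 0 \<le> r j" "\<And>j. r j < 1" "r \<longlonglongrightarrow> 1"
  shows "(\<lambda>j. \<Sum>n. r j ^ n * a n) \<longlonglongrightarrow> L"
proof -
  define s where "s n = (\<Sum>k\<le>n. a k)" for n
  have s: "s \<longlonglongrightarrow> L"
    using a unfolding s_def sums_def_le by simp
  obtain B where B: "\<And>n. \<bar>s n\<bar> \<le> B"
    using convergent_imp_Bseq[OF convergentI[OF s]] by (auto simp: Bseq_def)
  have "(\<Sum>n. r j ^ n * a n) = (1 - r j) * (\<Sum>n. r j ^ n * s n)" for j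
  proof -
    have "summable (\<lambda>n. r j ^ n * B)"
      using r(1,2)[of j] by (intro summable_mult2 summable_geometric) auto
    then have "summable (\<lambda>n. r j ^ n * s n)"
      by (rule summable_comparison_test') (use B r(1)[of j] in \<open>simp add: abs_mult mult_left_mono\<close>)
    then have S: "(\<lambda>n. r j ^ n * s n) sums (\<Sum>n. r j ^ n * s n)"
      by (rule summable_sums)
    have "(\<lambda>n. r j ^ Suc n * s n) sums (r j * (\<Sum>n. r j ^ n * s n))"
      using sums_mult[OF S, of "r j"] by (simp add: mult_ac)
    then have "(\<lambda>n. case n of 0 \<Rightarrow> 0 | Suc m \<Rightarrow> r j ^ Suc m * s m) sums (r j * (\<Sum>n. r j ^ n * s n))"
      using sums_Suc_iff[of "\<lambda>n. case n of 0 \<Rightarrow> 0 | Suc m \<Rightarrow> r j ^ Suc m * s m" "r j * (\<Sum>n. r j ^ n * s n)"]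
      by simp
    from sums_diff[OF S this]
    have "(\<lambda>n. r j ^ n * s n - (case n of 0 \<Rightarrow> 0 | Suc m \<Rightarrow> r j ^ Suc m * s m)) sums
      ((1 - r j) * (\<Sum>n. r j ^ n * s n))"
      by (simp add: algebra_simps)
    also have "(\<lambda>n. r j ^ n * s n - (case n of 0 \<Rightarrow> 0 | Suc m \<Rightarrow> r j ^ Suc m * s m)) = (\<lambda>n. r j ^ n * a n)"
      by (auto simp: fun_eq_iff s_def algebra_simps split: nat.split)
    finally show ?thesis by (simp add: sums_iff)
  qed
  then show ?thesis using abel_mean_tendsto[OF s r] by simp
qed

section \<open>The Poisson kernel\<close>

text \<open>
  The real part of \<open>(1 + w) / (1 - w)\<close> at \<open>w = r exp (i t)\<close>.
\<close>

definition poisson_kernel :: "real \<Rightarrow> real \<Rightarrow> real" where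
  "poisson_kernel r t = (1 - r\<^sup>2) / (1 - 2 * r * cos t + r\<^sup>2)"

lemma poisson_denominator_ge:
  fixes r t :: real
  assumes "0 \<le> r" shows "(1 - r)\<^sup>2 \<le> 1 - 2 * r * cos t + r\<^sup>2"
  using mult_left_mono[OF cos_le_one[of t] assms] by (simp add: power2_eq_square algebra_simps)

lemma poisson_denominator_pos:
  fixes r t :: real
  assumes "0 \<le> r" "r < 1" shows "0 < 1 - 2 * r * cos t + r\<^sup>2"
  using poisson_denominator_ge[OF assms(1), of t] assms by (smt (verit) zero_less_power)

lemma poisson_kernel_nonneg: "0 \<le> r \<Longrightarrow> r < 1 \<Longrightarrow> 0 \<le> poisson_kernel r t"
  unfolding poisson_kernel_def using poisson_denominator_pos[of r t]
  by (intro divide_nonneg_pos) (simp_all add: power_le_one)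

text \<open>
  The kernel decreases with the distance on the circle. This is the property for which Abel means are
  preferred to Fejer means, whose kernel oscillates.
\<close>

lemma poisson_kernel_mono:
  assumes "0 \<le> r" "r < 1" "cos s \<le> cos t"
  shows "poisson_kernel r s \<le> poisson_kernel r t"
  unfolding poisson_kernel_def using assms poisson_denominator_pos[of r t]
    mult_left_mono[OF assms(3,1)]
  by (intro divide_left_mono mult_pos_pos poisson_denominator_pos) (auto simp: power_le_one)

lemma poisson_kernel_zero: "0 \<le> r \<Longrightarrow> r < 1 \<Longrightarrow> poisson_kernel r 0 = (1 + r) / (1 - r)"
proof -
  assume r: "0 \<le> r" "r < 1"
  have "poisson_kernel r 0 = ((1 + r) * (1 - r)) / ((1 - r) * (1 - r))"
    by (simp add: poisson_kernel_def power2_eq_square algebra_simps)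
  then show ?thesis using r by simp
qed

lemma poisson_kernel_le:
  "0 \<le> r \<Longrightarrow> r < 1 \<Longrightarrow> poisson_kernel r t \<le> (1 + r) / (1 - r)"
  using poisson_kernel_mono[of r t 0] by (simp add: poisson_kernel_zero)

lemma continuous_poisson_kernel:
  fixes f :: "real \<Rightarrow> real"
  assumes "0 \<le> r" "r < 1" "continuous_on S f"
  shows "continuous_on S (\<lambda>x. poisson_kernel r (f x))"
  unfolding poisson_kernel_def using assms(3) poisson_denominator_pos[OF assms(1,2)]
  by (intro continuous_intros) (auto simp: less_imp_neq[THEN not_sym])

lemma poisson_kernel_measurable [measurable]:
  "0 \<le> r \<Longrightarrow> r < 1 \<Longrightarrow> poisson_kernel r \<in> borel_measurable borel"
  by (intro borel_measurable_continuous_onI continuous_poisson_kernel continuous_on_id)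

lemma poisson_kernel_sums:
  assumes "0 \<le> r" "r < 1"
  shows "(\<lambda>n. 2 * (r ^ n * cos (real n * t))) sums (poisson_kernel r t + 1)"
proof -
  define w where "w = of_real r * cis t"
  have "norm w < 1" using assms by (simp add: w_def norm_mult)
  then have "(\<lambda>n. Re (w ^ n)) sums Re (1 / (1 - w))"
    by (intro sums_Re geometric_sums)
  moreover have "Re (w ^ n) = r ^ n * cos (real n * t)" for n
    by (simp add: w_def power_mult_distrib Complex.DeMoivre flip: of_real_power)
  moreover have "2 * Re (1 / (1 - w)) = poisson_kernel r t + 1"
  proof -
    have d: "(1 - r * cos t)\<^sup>2 + (r * sin t)\<^sup>2 = 1 - 2 * r * cos t + r\<^sup>2"
      using sin_cos_squared_add[of t] by algebra
    have "Re (1 / (1 - w)) = (1 - r * cos t) / (1 - 2 * r * cos t + r\<^sup>2)"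
      by (simp add: Re_divide w_def d)
    then show ?thesis
      using poisson_denominator_pos[OF assms, of t] by (simp add: poisson_kernel_def field_simps)
  qed
  ultimately show ?thesis
    using sums_mult[of "\<lambda>n. r ^ n * cos (real n * t)" "Re (1 / (1 - w))" 2] by simp
qed

text \<open>
  Seen from a point \<open>x\<close> of the circle, every point of \<open>E\<close> lies behind one of the two points of \<open>E\<close>
  that come first in either direction, and is at least as close to that one as to \<open>x\<close>. With the
  circle cut open at \<open>\<pi>\<close>, the way to such a first point may pass the cut, which adds the two extreme
  points of \<open>E\<close>.
\<close>

lemma circle_four_points:
  assumes E: "compact E" "E \<subseteq> {-pi..pi}" "E \<noteq> {}" and x: "x \<in> {-pi..pi}"
  obtains Z where "Z \<subseteq> E" "finite Z" "card Z \<le> 4"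
    "\<And>y. y \<in> E \<Longrightarrow> \<exists>z\<in>Z. cos (y - x) \<le> cos (y - z)"
proof -
  obtain hi where hi: "hi \<in> E" "\<And>y. y \<in> E \<Longrightarrow> y \<le> hi"
    using compact_attains_sup[OF E(1,3)] by blast
  obtain lo where lo: "lo \<in> E" "\<And>y. y \<in> E \<Longrightarrow> lo \<le> y"
    using compact_attains_inf[OF E(1,3)] by blast
  \<comment> \<open>If no point of \<open>E\<close> lies beyond \<open>x\<close>, the condition is void and any point of \<open>E\<close> will do.\<close>
  have "\<exists>p\<in>E. \<forall>y\<in>E. x \<le> y \<longrightarrow> x \<le> p \<and> p \<le> y"
  proof (cases "E \<inter> {x..} = {}")
    case False
    have "compact (E \<inter> {x..})" using E(1) by (rule compact_Int_closed) simp
    from compact_attains_inf[OF this False] show ?thesis by blast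
  qed (use hi(1) in auto)
  then obtain p where p: "p \<in> E" "\<And>y. y \<in> E \<Longrightarrow> x \<le> y \<Longrightarrow> x \<le> p \<and> p \<le> y" by blast
  have "\<exists>q\<in>E. \<forall>y\<in>E. y \<le> x \<longrightarrow> q \<le> x \<and> y \<le> q"
  proof (cases "E \<inter> {..x} = {}")
    case False
    have "compact (E \<inter> {..x})" using E(1) by (rule compact_Int_closed) simp
    from compact_attains_sup[OF this False] show ?thesis by blast
  qed (use hi(1) in auto)
  then obtain q where q: "q \<in> E" "\<And>y. y \<in> E \<Longrightarrow> y \<le> x \<Longrightarrow> q \<le> x \<and> y \<le> q" by blast
  have cosle: "cos u \<le> cos v" if "\<bar>v\<bar> \<le> \<bar>u\<bar>" "\<bar>u\<bar> \<le> pi" for u v :: real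
    using cos_monotone_0_pi_le[of "\<bar>v\<bar>" "\<bar>u\<bar>"] that by simp
  have per: "cos (y - x) = cos (2 * pi - \<bar>y - x\<bar>)" for y
    using cos_2pi_minus[of "\<bar>y - x\<bar>"] by simp
  show ?thesis
  proof (rule that[of "{p, q, hi, lo}"])
    show "{p, q, hi, lo} \<subseteq> E" using p(1) q(1) hi(1) lo(1) by auto
    show "card {p, q, hi, lo} \<le> 4" by (simp add: card_insert_if)
    fix y assume y: "y \<in> E"
    have b: "- pi \<le> y" "y \<le> pi" "- pi \<le> x" "x \<le> pi" "hi \<le> pi" "- pi \<le> lo"
      using y x E(2) hi(1) lo(1) by auto
    consider "x \<le> y" "y - x \<le> pi" | "x \<le> y" "y - x > pi" | "y \<le> x" "x - y \<le> pi" | "y \<le> x" "x - y > pi"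
      by linarith
    then show "\<exists>z\<in>{p, q, hi, lo}. cos (y - x) \<le> cos (y - z)"
    proof cases
      case 1
      then have "cos (y - x) \<le> cos (y - p)" using p(2)[OF y] by (intro cosle) linarith+
      then show ?thesis by blast
    next
      case 2
      have "cos (y - x) \<le> cos (y - hi)"
        using 2 hi(2)[OF y] b unfolding per[of y] by (intro cosle) linarith+
      then show ?thesis by blast
    next
      case 3
      then have "cos (y - x) \<le> cos (y - q)" using q(2)[OF y] by (intro cosle) linarith+
      then show ?thesis by blast
    next
      case 4
      have "cos (y - x) \<le> cos (y - lo)"
        using 4 lo(2)[OF y] b unfolding per[of y] by (intro cosle) linarith+
      then show ?thesis by blast
    qed
  qed auto
qed

section \<open>Positive definite sequences and Herglotz' theorem\<close>

lemma
  fixes f :: "real \<Rightarrow> 'b::euclidean_space"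
  assumes "continuous_on {a..b} f"
  shows integrable_restrict_lborel_interval: "integrable (restrict_space lborel {a..b}) f"
    and integral_restrict_lborel_interval: "integral\<^sup>L (restrict_space lborel {a..b}) f = integral {a..b} f"
proof -
  have "set_integrable lborel {a..b} f"
    using assms by (rule borel_integrable_atLeastAtMost')
  then show "integrable (restrict_space lborel {a..b}) f"
      "integral\<^sup>L (restrict_space lborel {a..b}) f = integral {a..b} f"
    using set_borel_integral_eq_integral(2)[of "{a..b}" f]
    by (simp_all add: integrable_restrict_space integral_restrict_space set_integrable_def
      set_lebesgue_integral_def)
qed

lemma has_integral_cis:
  "((\<lambda>x. cis (of_int n * x)) has_integral (if n = 0 then 2 * of_real pi else 0)) {-pi..pi}"
proof (cases "n = 0")
  case True
  then show ?thesis using has_integral_const_real[of "1::complex" "-pi" pi] by (simp add: scaleR_conv_of_real)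
next
  case False
  let ?G = "\<lambda>x. cis (of_int n * x) / (\<i> * of_int n)"
  have "((\<lambda>x. cis (of_int n * x)) has_integral (?G pi - ?G (-pi))) {-pi..pi}"
  proof (rule fundamental_theorem_of_calculus)
    fix x :: real
    have "((\<lambda>x. exp (\<i> * of_int n * of_real x)) has_vector_derivative
        (of_int n * \<i>) * exp (\<i> * of_int n * of_real x)) (at x within {-pi..pi})"
      by (auto intro!: derivative_eq_intros has_vector_derivative_real_field simp: mult_ac)
    then have "((\<lambda>x. exp (\<i> * of_int n * of_real x) * (1 / (\<i> * of_int n))) has_vector_derivative
        (of_int n * \<i>) * exp (\<i> * of_int n * of_real x) * (1 / (\<i> * of_int n))) (at x within {-pi..pi})"
      by (rule has_vector_derivative_mult_left)
    then show "(?G has_vector_derivative cis (of_int n * x)) (at x within {-pi..pi})"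
      using False by (simp add: cis_conv_exp mult_ac)
  qed simp
  moreover have "cis (of_int n * pi) = cis (of_int n * (- pi))"
    by (simp add: complex_eq_iff)  (metis mult.commute mult_minus_right sin_npi_int sin_minus neg_equal_zero)
  ultimately show ?thesis using False by simp
qed

text \<open>
  The quadratic form of the Toeplitz matrix \<open>c (t - s)\<close> at the vector of exponentials. It is \<open>T\<close> times
  the Fejer mean of the series with coefficients \<open>c\<close>, and its positivity for all \<open>T\<close> and \<open>x\<close> is the
  form of positive definiteness used here.
\<close>

definition toeplitz_form :: "(int \<Rightarrow> complex) \<Rightarrow> nat \<Rightarrow> real \<Rightarrow> complex" where
  "toeplitz_form c T x = (\<Sum>s\<in>{1..int T}. \<Sum>t\<in>{1..int T}. c (t - s) * cis (- (of_int (t - s) * x)))"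

lemma continuous_toeplitz_form: "continuous_on S (toeplitz_form c T)"
  unfolding toeplitz_form_def cis_conv_exp by (intro continuous_intros)

lemma card_pairs_with_difference:
  "(\<Sum>s\<in>{1..int T}. \<Sum>t\<in>{1..int T}. if t - s = int n then 1 else 0) = real (T - n)"
proof -
  have "(\<Sum>s\<in>{1..int T}. \<Sum>t\<in>{1..int T}. if t - s = int n then 1 else (0::real)) =
     (\<Sum>s\<in>{1..int T}. \<Sum>t\<in>{1..int T}. if t = s + int n then 1 else 0)"
    by (intro sum.cong) auto
  also have "\<dots> = (\<Sum>s\<in>{1..int T}. if s \<in> {1..int T - int n} then 1 else 0)"
    by (intro sum.cong) auto
  also have "\<dots> = real (card ({1..int T} \<inter> {1..int T - int n}))"
    by (subst sum.inter_restrict[symmetric]) simp_all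
  also have "{1..int T} \<inter> {1..int T - int n} = {1..int T - int n}" by auto
  finally show ?thesis by (simp add: nat_diff_distrib' of_nat_diff_if) 
qed

lemma integral_toeplitz_form:
  "((\<lambda>x. cis (real n * x) * toeplitz_form c T x) has_integral
      (2 * of_real pi * of_nat (T - n) * c (int n))) {-pi..pi}"
proof -
  have "((\<lambda>x. \<Sum>s\<in>{1..int T}. \<Sum>t\<in>{1..int T}. c (t - s) * cis (of_int (int n - (t - s)) * x)) has_integral
     (\<Sum>s\<in>{1..int T}. \<Sum>t\<in>{1..int T}. c (t - s) * (if int n - (t - s) = 0 then 2 * of_real pi else 0))) {-pi..pi}"
    by (intro has_integral_sum has_integral_mult_right has_integral_cis) auto
  also have "(\<Sum>s\<in>{1..int T}. \<Sum>t\<in>{1..int T}. c (t - s) * (if int n - (t - s) = 0 then 2 * of_real pi else 0))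
    = (\<Sum>s\<in>{1..int T}. \<Sum>t\<in>{1..int T}. (2 * of_real pi * c (int n)) * of_real (if t - s = int n then 1 else 0))"
    by (intro sum.cong) auto
  also have "\<dots> = (2 * of_real pi * c (int n)) * of_real (\<Sum>s\<in>{1..int T}. \<Sum>t\<in>{1..int T}. if t - s = int n then 1 else 0)"
    by (simp only: of_real_sum sum_distrib_left)
  also have "\<dots> = 2 * of_real pi * of_nat (T - n) * c (int n)"
    by (simp only: card_pairs_with_difference) simp
  also have "(\<lambda>x. \<Sum>s\<in>{1..int T}. \<Sum>t\<in>{1..int T}. c (t - s) * cis (of_int (int n - (t - s)) * x))
     = (\<lambda>x. cis (real n * x) * toeplitz_form c T x)"
    by (auto simp: fun_eq_iff toeplitz_form_def sum_distrib_left cis_mult algebra_simps intro!: sum.cong)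
  finally show ?thesis .
qed

lemma toeplitz_form_real:
  assumes "\<And>n. c (- n) = cnj (c n)"
  shows "toeplitz_form c T x = of_real (Re (toeplitz_form c T x))"
proof -
  have "cnj (toeplitz_form c T x) = toeplitz_form c T x"
    unfolding toeplitz_form_def cnj_sum
    by (subst sum.swap) (auto simp: cis_cnj assms[symmetric] algebra_simps intro!: sum.cong)
  then show ?thesis by (metis Reals_cnj_iff of_real_Re)
qed

text \<open>
  The Fejer means are probability densities on \<open>[-\<pi>, \<pi>]\<close> whose Fourier coefficients tend to \<open>c\<close>.
  Living on a bounded interval they form a tight family, and \<open>\<mu>\<close> is a weak limit of a subsequence.
\<close>

theorem herglotz:
  fixes c :: "int \<Rightarrow> complex"
  assumes herm: "\<And>n. c (- n) = cnj (c n)"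
    and pos: "\<And>T x. 0 \<le> Re (toeplitz_form c T x)"
    and one: "c 0 = 1"
  obtains \<mu> where "real_distribution \<mu>" "AE x in \<mu>. x \<in> {-pi..pi}" "\<And>n. char \<mu> (real n) = c (int n)"
proof -
  define g where "g N x = indicator {-pi..pi} x * (Re (toeplitz_form c (Suc N) x) / (2 * pi * Suc N))" for N x
  have g_nonneg: "0 \<le> g N x" for N x
    unfolding g_def using pos by (intro mult_nonneg_nonneg divide_nonneg_nonneg) auto
  have cont: "continuous_on {-pi..pi} (\<lambda>x. Re (toeplitz_form c T x))" for T
    by (intro continuous_intros continuous_toeplitz_form)
  have [measurable]: "toeplitz_form c T \<in> borel_measurable borel" for T
    by (intro borel_measurable_continuous_onI continuous_toeplitz_form)
  have g_meas[measurable]: "g N \<in> borel_measurable borel" for N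
    unfolding g_def by measurable
  define \<nu> where "\<nu> N = density lborel (\<lambda>x. ennreal (g N x))" for N
  have int\<nu>: "integral\<^sup>L (\<nu> N) f = integral {-pi..pi} (\<lambda>x. f x * toeplitz_form c (Suc N) x) / of_real (2 * pi * Suc N)"
    if f: "continuous_on UNIV f" for N and f :: "real \<Rightarrow> complex"
  proof -
    have [measurable]: "f \<in> borel_measurable borel" using f by (rule borel_measurable_continuous_onI)
    have "integral\<^sup>L (\<nu> N) f = (\<integral>x. g N x *\<^sub>R f x \<partial>lborel)"
      unfolding \<nu>_def by (rule integral_density) (auto simp: g_nonneg)
    also have "\<dots> = (\<integral>x. indicator {-pi..pi} x *\<^sub>R (f x * toeplitz_form c (Suc N) x / of_real (2 * pi * Suc N)) \<partial>lborel)"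
      by (intro Bochner_Integration.integral_cong refl, subst toeplitz_form_real[where c = c, OF herm])
        (auto simp: g_def scaleR_conv_of_real indicator_def)
    also have "\<dots> = integral\<^sup>L (restrict_space lborel {-pi..pi}) (\<lambda>x. f x * toeplitz_form c (Suc N) x / of_real (2 * pi * Suc N))"
      by (subst integral_restrict_space) auto
    also have "\<dots> = integral {-pi..pi} (\<lambda>x. f x * toeplitz_form c (Suc N) x / of_real (2 * pi * Suc N))"
      by (intro integral_restrict_lborel_interval continuous_intros continuous_toeplitz_form
        continuous_on_subset[OF f]) (auto simp del: of_nat_Suc)
    finally show ?thesis by (simp add: integral_divide)
  qed
  have char\<nu>: "char (\<nu> N) (real n) = of_nat (Suc N - n) / of_nat (Suc N) * c (int n)" for N n
  proof -
    have "char (\<nu> N) (real n) = integral\<^sup>L (\<nu> N) (\<lambda>x. cis (real n * x))"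
      by (simp add: char_def cis_conv_exp)
    also have "\<dots> = (2 * of_real pi * of_nat (Suc N - n) * c (int n)) / of_real (2 * pi * Suc N)"
    proof -
      have "continuous_on UNIV (\<lambda>x. cis (real n * x))"
        unfolding cis_conv_exp by (intro continuous_intros)
      from int\<nu>[OF this] show ?thesis
        by (simp only: integral_unique[OF integral_toeplitz_form])
    qed
    finally show ?thesis by (simp add: field_simps del: of_nat_Suc)
  qed
  have emb: "emeasure (\<nu> N) (UNIV - {-pi..pi}) = 0" for N
  proof -
    have "emeasure (\<nu> N) (UNIV - {-pi..pi}) = (\<integral>\<^sup>+x. ennreal (g N x) * indicator (UNIV - {-pi..pi}) x \<partial>lborel)"
      unfolding \<nu>_def by (rule emeasure_density) auto
    also have "\<dots> = (\<integral>\<^sup>+x. 0 \<partial>(lborel::real measure))"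
      by (intro nn_integral_cong) (auto simp: g_def indicator_def)
    finally show ?thesis by simp
  qed
  have rd: "real_distribution (\<nu> N)" for N
  proof -
    have "g N = (\<lambda>x. indicator {-pi..pi} x *\<^sub>R (Re (toeplitz_form c (Suc N) x) / (2 * pi * Suc N)))"
      by (simp add: g_def fun_eq_iff)
    moreover have "set_integrable lborel {-pi..pi} (\<lambda>x. Re (toeplitz_form c (Suc N) x) / (2 * pi * Suc N))"
      by (intro borel_integrable_atLeastAtMost' continuous_intros cont) auto
    ultimately have "integrable lborel (g N)"
      by (simp add: set_integrable_def)
    then have "emeasure (\<nu> N) UNIV = ennreal (\<integral>x. g N x \<partial>lborel)"
      by (simp add: \<nu>_def emeasure_density nn_integral_eq_integral g_nonneg)
    moreover have "(\<integral>x. g N x \<partial>lborel) = 1"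
    proof -
      have "complex_of_real (\<integral>x. g N x \<partial>lborel) = (\<integral>x. complex_of_real (g N x) \<partial>lborel)"
        by simp
      also have "\<dots> = char (\<nu> N) (real 0)"
        unfolding char_def \<nu>_def
        by (subst integral_density) (auto simp: g_nonneg scaleR_conv_of_real)
      also have "\<dots> = 1" by (subst char\<nu>) (simp add: one del: of_nat_Suc)
      finally show ?thesis by simp
    qed
    ultimately show ?thesis
      by (intro real_distribution.intro prob_spaceI real_distribution_axioms.intro) (auto simp: \<nu>_def)
  qed
  have "tight \<nu>"
    unfolding tight_def
  proof (intro conjI allI impI rd)
    fix e :: real assume "e > 0"
    \<comment> \<open>Any bounded interval around \<open>[-\<pi>, \<pi>]\<close> serves; recall \<open>\<pi> < 4\<close>.\<close>
    have "measure (\<nu> N) {-4<..4} = 1" for N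
    proof -
      interpret real_distribution "\<nu> N" by (rule rd)
      have "AE x in \<nu> N. x \<in> {-pi..pi}"
        using emb[of N] by (intro AE_I[of _ _ "UNIV - {-pi..pi}"]) auto
      then have "AE x in \<nu> N. x \<in> {-4<..4}"
        by eventually_elim (use pi_less_4 in auto)
      then show ?thesis by (subst prob_eq_1) auto
    qed
    then show "\<exists>a b. a < b \<and> (\<forall>n. 1 - e < measure (\<nu> n) {a<..b})"
      using \<open>e > 0\<close> by (intro exI[of _ "-4"] exI[of _ 4]) auto
  qed
  from tight_imp_convergent_subsubsequence[OF this strict_mono_id]
  obtain k \<mu> where k: "strict_mono k" and \<mu>: "real_distribution \<mu>" and weak: "weak_conv_m (\<nu> \<circ> k) \<mu>"
    by auto
  have rdk: "real_distribution ((\<nu> \<circ> k) n)" for n by (simp add: rd)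
  have char\<mu>: "char \<mu> (real n) = c (int n)" for n
  proof (rule LIMSEQ_unique[OF levy_continuity1[OF rdk \<mu> weak]])
    have "(\<lambda>N. real (Suc N - n) / real (Suc N)) \<longlonglongrightarrow> 1"
    proof (rule Lim_transform_eventually)
      show "(\<lambda>N. 1 - real n / real (Suc N)) \<longlonglongrightarrow> 1"
        using tendsto_diff[OF tendsto_const LIMSEQ_ignore_initial_segment[OF lim_const_over_n[of "real n"], of 1], of 1]
        by simp
      show "\<forall>\<^sub>F N in sequentially. 1 - real n / real (Suc N) = real (Suc N - n) / real (Suc N)"
        using eventually_ge_at_top[of n]
        by eventually_elim (auto simp: of_nat_diff field_simps)
    qed
    then have "(\<lambda>N. complex_of_real (real (Suc N - n) / real (Suc N)) * c (int n)) \<longlonglongrightarrow> of_real 1 * c (int n)"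
      by (intro tendsto_intros)
    then have "(\<lambda>N. char (\<nu> N) (real n)) \<longlonglongrightarrow> c (int n)"
      by (simp add: char\<nu> del: of_nat_Suc)
    from LIMSEQ_subseq_LIMSEQ[OF this k] show "(\<lambda>N. char ((\<nu> \<circ> k) N) (real n)) \<longlonglongrightarrow> c (int n)"
      by (simp add: o_def)
  qed
  have "AE x in \<mu>. x \<in> {-pi..pi}"
  proof -
    interpret \<mu>: real_distribution \<mu> by (rule \<mu>)
    \<comment> \<open>A bounded continuous test function that vanishes exactly on the interval.\<close>
    let ?d = "\<lambda>x. min 1 (infdist x {-pi..pi})"
    have [measurable]: "?d \<in> borel_measurable borel"
      by (intro borel_measurable_continuous_onI continuous_intros)
    have b: "norm (?d x) \<le> 1" for x using infdist_nonneg[of x "{-pi..pi}"] by simp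
    have "(\<lambda>n. integral\<^sup>L ((\<nu> \<circ> k) n) ?d) \<longlonglongrightarrow> integral\<^sup>L \<mu> ?d"
      by (rule weak_conv_imp_integral_bdd_continuous_conv[OF rdk \<mu> weak _ b])
        (intro continuous_intros)
    moreover have "integral\<^sup>L (\<nu> N) ?d = 0" for N
    proof -
      have "AE x in \<nu> N. x \<in> {-pi..pi}"
        using emb[of N] by (intro AE_I[of _ _ "UNIV - {-pi..pi}"]) (auto simp: \<nu>_def)
      then have "AE x in \<nu> N. ?d x = 0" by eventually_elim auto
      then show ?thesis by (rule integral_eq_zero_AE)
    qed
    ultimately have "integral\<^sup>L \<mu> ?d = 0" by (simp add: LIMSEQ_const_iff)
    moreover have "integrable \<mu> ?d"
      by (rule \<mu>.integrable_const_bound[of _ 1]) (use b in auto)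
    ultimately have "AE x in \<mu>. ?d x = 0"
      by (subst (asm) integral_nonneg_eq_0_iff_AE) (auto simp: infdist_nonneg)
    then show ?thesis
    proof eventually_elim
      case (elim x)
      then have "infdist x {-pi..pi} = 0" by (auto simp: min_def split: if_splits)
      then show ?case using in_closed_iff_infdist_zero[of "{-pi..pi}" x] by auto
    qed
  qed
  then show ?thesis using that \<mu> char\<mu> by blast
qed

section \<open>Poisson integrals of probability measures on the circle\<close>

text \<open>
  The set \<open>B\<close> restricts the measure, so that the contributions of different parts of \<open>\<mu>\<close> can be
  separated.
\<close>

definition poisson_integral :: "real measure \<Rightarrow> real \<Rightarrow> real set \<Rightarrow> real \<Rightarrow> real" where
  "poisson_integral \<mu> r B x = (\<integral>y. indicator B y * poisson_kernel r (y - x) \<partial>\<mu>)"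

context real_distribution
begin

lemma integrable_poisson_kernel:
  assumes "0 \<le> r" "r < 1" "B \<in> sets borel"
  shows "integrable M (\<lambda>y. indicator B y * poisson_kernel r (y - x))"
proof (rule integrable_const_bound)
  note [measurable] = assms(3) poisson_kernel_measurable[OF assms(1,2)]
  show "(\<lambda>y. indicator B y * poisson_kernel r (y - x)) \<in> borel_measurable M" by measurable
  show "AE y in M. norm (indicator B y * poisson_kernel r (y - x)) \<le> (1 + r) / (1 - r)"
    using poisson_kernel_le[OF assms(1,2)] poisson_kernel_nonneg[OF assms(1,2)] assms
    by (intro AE_I2) (auto simp: indicator_def)
qed

lemma poisson_integral_nonneg:
  assumes "0 \<le> r" "r < 1" shows "0 \<le> poisson_integral M r B x"
  unfolding poisson_integral_def using poisson_kernel_nonneg[OF assms]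
  by (intro integral_nonneg_AE AE_I2) simp

lemma poisson_integral_split:
  assumes "0 \<le> r" "r < 1" "B \<in> sets borel"
  shows "poisson_integral M r UNIV x = poisson_integral M r B x + poisson_integral M r (- B) x"
proof -
  have "poisson_integral M r UNIV x =
    (\<integral>y. indicator B y * poisson_kernel r (y - x) + indicator (- B) y * poisson_kernel r (y - x) \<partial>M)"
    unfolding poisson_integral_def by (intro Bochner_Integration.integral_cong) (auto simp: indicator_def)
  then show ?thesis
    using assms by (simp add: poisson_integral_def integrable_poisson_kernel)
qed

lemma poisson_integral_measurable [measurable]:
  assumes "0 \<le> r" "r < 1" "B \<in> sets borel"
  shows "poisson_integral M r B \<in> borel_measurable borel"
proof -
  note [measurable] = assms(3) poisson_kernel_measurable[OF assms(1,2)]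
  show ?thesis unfolding poisson_integral_def by measurable
qed

lemma isCont_poisson_integral:
  assumes r: "0 \<le> r" "r < 1"
  shows "isCont (poisson_integral M r UNIV) x"
  unfolding continuous_at_sequentially o_def
proof (intro allI impI)
  fix X assume X: "X \<longlonglongrightarrow> x"
  note [measurable] = poisson_kernel_measurable[OF r]
  show "(\<lambda>n. poisson_integral M r UNIV (X n)) \<longlonglongrightarrow> poisson_integral M r UNIV x"
    unfolding poisson_integral_def
  proof (rule integral_dominated_convergence)
    show "AE y in M. (\<lambda>n. indicator UNIV y * poisson_kernel r (y - X n)) \<longlonglongrightarrow> indicator UNIV y * poisson_kernel r (y - x)"
    proof (intro AE_I2 tendsto_intros)
      fix y
      have "isCont (poisson_kernel r) (y - x)"
        using continuous_poisson_kernel[OF r, of UNIV "\<lambda>x. x"]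
        by (simp add: continuous_on_eq_continuous_at)
      then show "(\<lambda>n. poisson_kernel r (y - X n)) \<longlonglongrightarrow> poisson_kernel r (y - x)"
        by (rule isCont_tendsto_compose) (intro tendsto_intros X)
    qed
    show "AE y in M. norm (indicator UNIV y * poisson_kernel r (y - X n)) \<le> (1 + r) / (1 - r)" for n
      using poisson_kernel_le[OF r] poisson_kernel_nonneg[OF r] by (intro AE_I2) simp
    show "integrable M (\<lambda>y. (1 + r) / (1 - r))" by simp
  qed measurable
qed

text \<open>
  The Poisson integral is the Abel mean of the Fourier series of the measure. The doubled series below
  counts the constant term twice, whence the summand \<open>1\<close>.
\<close>

lemma poisson_integral_sums:
  assumes r: "0 \<le> r" "r < 1"
  shows "(\<lambda>n. 2 * (r ^ n * Re (char M (real n) * cis (- (real n * x))))) sums (poisson_integral M r UNIV x + 1)"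
proof -
  let ?f = "\<lambda>n y. 2 * (r ^ n * cos (real n * (y - x)))"
  have int: "integrable M (?f n)" for n
    by (rule integrable_const_bound[of _ "2 * r ^ n"]) (use r in \<open>auto simp: abs_mult mult_left_le\<close>)
  have le: "norm (?f n y) \<le> 2 * r ^ n" for n y
    using r by (auto simp: abs_mult mult_left_le)
  have geo: "summable (\<lambda>n. 2 * r ^ n)" using r by (intro summable_mult summable_geometric) auto
  have "(\<lambda>n. integral\<^sup>L M (?f n)) sums (\<integral>y. (\<Sum>n. ?f n y) \<partial>M)"
  proof (rule sums_integral[OF int])
    show "AE y in M. summable (\<lambda>n. norm (?f n y))"
      by (intro AE_I2 summable_comparison_test'[OF geo]) (use le in simp)
    show "summable (\<lambda>n. \<integral>y. norm (?f n y) \<partial>M)"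
    proof (rule summable_comparison_test'[OF geo])
      fix n
      have "(\<integral>y. norm (?f n y) \<partial>M) \<le> (\<integral>y. 2 * r ^ n \<partial>M)"
        by (intro integral_mono integrable_norm int) (use le in auto)
      then show "norm (\<integral>y. norm (?f n y) \<partial>M) \<le> 2 * r ^ n" by (simp add: prob_space[simplified])
    qed
  qed
  also have "(\<lambda>n. integral\<^sup>L M (?f n)) = (\<lambda>n. 2 * (r ^ n * Re (char M (real n) * cis (- (real n * x)))))"
  proof
    fix n
    have i: "integrable M (\<lambda>y. iexp (real n * y))"
      by (rule integrable_iexp) simp_all
    have "Re (char M (real n) * cis (- (real n * x))) = Re (\<integral>y. iexp (real n * y) * cis (- (real n * x)) \<partial>M)"
      by (simp add: char_def)
    also have "\<dots> = (\<integral>y. Re (iexp (real n * y) * cis (- (real n * x))) \<partial>M)"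
      using i by (intro integral_Re[symmetric]) simp
    also have "\<dots> = (\<integral>y. cos (real n * (y - x)) \<partial>M)"
    proof (intro Bochner_Integration.integral_cong refl)
      fix y
      have "iexp (real n * y) * cis (- (real n * x)) = cis (real n * y + - (real n * x))"
        by (simp only: cis_mult cis_conv_exp[symmetric])
      also have "real n * y + - (real n * x) = real n * (y - x)" by (simp add: right_diff_distrib)
      finally show "Re (iexp (real n * y) * cis (- (real n * x))) = cos (real n * (y - x))" by simp
    qed
    finally show "integral\<^sup>L M (?f n) = 2 * (r ^ n * Re (char M (real n) * cis (- (real n * x))))" by simp
  qed
  also have "(\<integral>y. (\<Sum>n. ?f n y) \<partial>M) = (\<integral>y. poisson_kernel r (y - x) + 1 \<partial>M)"
    using poisson_kernel_sums[OF r] by (simp add: sums_iff)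
  also have "\<dots> = poisson_integral M r UNIV x + 1"
    using integrable_poisson_kernel[OF r, of UNIV x] by (simp add: poisson_integral_def prob_space[simplified])
  finally show ?thesis .
qed

text \<open>
  A bound on \<open>E\<close> for the Poisson integral of the whole measure bounds the Poisson integral of its part
  on \<open>E\<close> everywhere: the kernel centred at \<open>x\<close> is dominated on \<open>E\<close> by the sum of the kernels centred
  at the four points of \<open>E\<close> that shield \<open>x\<close> from \<open>E\<close>.
\<close>

lemma poisson_integral_maximum:
  assumes r: "0 \<le> r" "r < 1" and E: "compact E" "E \<subseteq> {-pi..pi}" and x: "x \<in> {-pi..pi}"
    and le: "\<And>z. z \<in> E \<Longrightarrow> poisson_integral M r UNIV z \<le> k" and k: "0 \<le> k"
  shows "poisson_integral M r E x \<le> 4 * k"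
proof (cases "E = {}")
  case True
  then show ?thesis using k by (simp add: poisson_integral_def)
next
  case False
  obtain Z where Z: "Z \<subseteq> E" "finite Z" "card Z \<le> 4"
      "\<And>y. y \<in> E \<Longrightarrow> \<exists>z\<in>Z. cos (y - x) \<le> cos (y - z)"
    using circle_four_points[OF E False x] by metis
  have int: "integrable M (\<lambda>y. poisson_kernel r (y - z))" for z
    using integrable_poisson_kernel[OF r, of UNIV z] by simp
  have "poisson_integral M r E x \<le> (\<integral>y. (\<Sum>z\<in>Z. poisson_kernel r (y - z)) \<partial>M)"
    unfolding poisson_integral_def
  proof (rule integral_mono)
    show "integrable M (\<lambda>y. indicator E y * poisson_kernel r (y - x))"
      by (intro integrable_poisson_kernel r borel_compact E)
    show "integrable M (\<lambda>y. \<Sum>z\<in>Z. poisson_kernel r (y - z))"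
      by (intro Bochner_Integration.integrable_sum int)
    fix y
    have nn: "0 \<le> (\<Sum>z\<in>Z. poisson_kernel r (y - z))"
      by (intro sum_nonneg poisson_kernel_nonneg r)
    show "indicator E y * poisson_kernel r (y - x) \<le> (\<Sum>z\<in>Z. poisson_kernel r (y - z))"
    proof (cases "y \<in> E")
      case True
      then obtain z where z: "z \<in> Z" "cos (y - x) \<le> cos (y - z)" using Z(4) by blast
      have "poisson_kernel r (y - x) \<le> poisson_kernel r (y - z)"
        by (rule poisson_kernel_mono[OF r z(2)])
      also have "\<dots> \<le> (\<Sum>z\<in>Z. poisson_kernel r (y - z))"
        by (intro member_le_sum z Z(2) poisson_kernel_nonneg r)
      finally show ?thesis using True by simp
    qed (use nn in simp)
  qed
  also have "\<dots> = (\<Sum>z\<in>Z. poisson_integral M r UNIV z)"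
    by (subst Bochner_Integration.integral_sum) (auto simp: int poisson_integral_def)
  also have "\<dots> \<le> real (card Z) * k"
    using sum_bounded_above[of Z "\<lambda>z. poisson_integral M r UNIV z" k] le Z(1) by auto
  also have "\<dots> \<le> 4 * k" using Z(3) k by (intro mult_right_mono) auto
  finally show ?thesis .
qed

end

abbreviation (input) circ :: "real measure" where
  "circ \<equiv> restrict_space lborel {-pi..pi}"

lemma finite_measure_circ: "finite_measure circ"
  by (rule finite_measureI) (simp add: emeasure_restrict_space space_restrict_space)

text \<open>
  Only the constant term of the series of the kernel survives integration over a period.
\<close>

lemma integral_poisson_kernel_shift:
  assumes r: "0 \<le> r" "r < 1"
  shows "(\<integral>x. poisson_kernel r (y - x) \<partial>circ) = 2 * pi"
proof -
  interpret finite_measure circ by (rule finite_measure_circ)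
  have sp: "measure circ {-pi..pi} = 2 * pi"
    by (simp add: measure_restrict_space)
  let ?f = "\<lambda>n x. 2 * (r ^ n * cos (real n * (y - x)))"
  have int: "integrable circ (?f n)" for n
    by (intro integrable_restrict_lborel_interval continuous_intros)
  have le: "norm (?f n x) \<le> 2 * r ^ n" for n x
    using r by (auto simp: abs_mult mult_left_le)
  have geo': "summable (\<lambda>n. 2 * r ^ n)" using r by (intro summable_mult summable_geometric) auto
  then have geo: "summable (\<lambda>n. 2 * r ^ n * (2 * pi))" by (rule summable_mult2)
  have "(\<lambda>n. integral\<^sup>L circ (?f n)) sums (\<integral>x. (\<Sum>n. ?f n x) \<partial>circ)"
  proof (rule sums_integral[OF int])
    show "AE x in circ. summable (\<lambda>n. norm (?f n x))"
      by (intro AE_I2 summable_comparison_test'[OF geo']) (use le in simp)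
    show "summable (\<lambda>n. \<integral>x. norm (?f n x) \<partial>circ)"
    proof (rule summable_comparison_test'[OF geo])
      fix n
      have "(\<integral>x. norm (?f n x) \<partial>circ) \<le> (\<integral>x. 2 * r ^ n \<partial>circ)"
        by (intro integral_mono integrable_norm int) (use le in auto)
      then show "norm (\<integral>x. norm (?f n x) \<partial>circ) \<le> 2 * r ^ n * (2 * pi)" by (simp add: space_restrict_space sp mult_ac)
    qed
  qed
  also have "(\<lambda>n. integral\<^sup>L circ (?f n)) = (\<lambda>n. if n = 0 then 4 * pi else 0)"
  proof
    fix n
    have "((\<lambda>x. Re (cis (real n * y) * cis (of_int (- int n) * x))) has_integral
        Re (cis (real n * y) * (if - int n = 0 then 2 * of_real pi else 0))) {-pi..pi}"
      using has_integral_linear[OF has_integral_mult_right[OF has_integral_cis] bounded_linear_Re,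
          of "cis (real n * y)" "- int n"]
      by (simp only: o_def)
    moreover have "Re (cis (real n * y) * cis (of_int (- int n) * x)) = cos (real n * (y - x))" for x
      by (simp only: cis_mult cis.sel) (simp add: right_diff_distrib)
    moreover have "Re (cis (real n * y) * (if - int n = 0 then 2 * of_real pi else 0)) = (if n = 0 then 2 * pi else 0)"
      by simp
    ultimately have "((\<lambda>x. cos (real n * (y - x))) has_integral (if n = 0 then 2 * pi else 0)) {-pi..pi}"
      by simp
    then have "integral {-pi..pi} (\<lambda>x. cos (real n * (y - x))) = (if n = 0 then 2 * pi else 0)"
      by (rule integral_unique)
    moreover have "integral\<^sup>L circ (\<lambda>x. cos (real n * (y - x))) = integral {-pi..pi} (\<lambda>x. cos (real n * (y - x)))"
      by (intro integral_restrict_lborel_interval continuous_intros)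
    ultimately show "integral\<^sup>L circ (?f n) = (if n = 0 then 4 * pi else 0)" by simp
  qed
  also have "(\<integral>x. (\<Sum>n. ?f n x) \<partial>circ) = (\<integral>x. poisson_kernel r (y - x) + 1 \<partial>circ)"
    using poisson_kernel_sums[OF r] by (simp add: sums_iff)
  also have "\<dots> = (\<integral>x. poisson_kernel r (y - x) \<partial>circ) + 2 * pi"
  proof -
    have "integrable circ (\<lambda>x. poisson_kernel r (y - x))"
      by (intro integrable_restrict_lborel_interval continuous_poisson_kernel[OF r] continuous_intros)
    then show ?thesis by (simp add: space_restrict_space sp)
  qed
  finally have "(\<lambda>n. if n = 0 then 4 * pi else 0) sums ((\<integral>x. poisson_kernel r (y - x) \<partial>circ) + 2 * pi)" .
  moreover have "(\<lambda>n. if n = 0 then 4 * pi else 0) sums (4 * pi)"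
    using sums_single[of 0 "\<lambda>_. 4 * pi"] by simp
  ultimately show ?thesis using sums_unique2 by fastforce
qed

lemma (in real_distribution)
  assumes r: "0 \<le> r" "r < 1" and B: "B \<in> sets borel"
  shows integrable_poisson_integral: "integrable circ (poisson_integral M r B)"
    and integral_poisson_integral: "integral\<^sup>L circ (poisson_integral M r B) = 2 * pi * prob B"
proof -
  interpret circ: finite_measure circ by (rule finite_measure_circ)
  interpret P: pair_sigma_finite circ M ..
  interpret PP: finite_measure "circ \<Otimes>\<^sub>M M"
    by (rule finite_measure_pair_measure) (unfold_locales)
  note [measurable] = B poisson_kernel_measurable[OF r]
  have [measurable]: "(\<lambda>x. x) \<in> borel_measurable circ"
    by (rule measurable_restrict_space1) simp
  let ?f = "\<lambda>(x, y). indicator B y * poisson_kernel r (y - x)"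
  have int: "integrable (circ \<Otimes>\<^sub>M M) ?f"
  proof (rule PP.integrable_const_bound)
    show "?f \<in> borel_measurable (circ \<Otimes>\<^sub>M M)" by measurable
    show "AE z in circ \<Otimes>\<^sub>M M. norm (?f z) \<le> (1 + r) / (1 - r)"
      using poisson_kernel_le[OF r] poisson_kernel_nonneg[OF r] r
      by (intro AE_I2) (auto simp: indicator_def)
  qed
  show "integrable circ (poisson_integral M r B)"
    using P.integrable_fst[OF int] by (simp add: poisson_integral_def[abs_def])
  have "integral\<^sup>L circ (poisson_integral M r B) = (\<integral>x. \<integral>y. indicator B y * poisson_kernel r (y - x) \<partial>M \<partial>circ)"
    by (simp add: poisson_integral_def[abs_def])
  also have "\<dots> = (\<integral>y. \<integral>x. indicator B y * poisson_kernel r (y - x) \<partial>circ \<partial>M)"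
    using P.Fubini_integral[OF int] by simp
  also have "\<dots> = (\<integral>y. indicator B y * (2 * pi) \<partial>M)"
    by (simp add: integral_poisson_kernel_shift[OF r])
  finally show "integral\<^sup>L circ (poisson_integral M r B) = 2 * pi * prob B" by simp
qed

section \<open>Positive definite trigonometric series that converge off one point\<close>

lemma sum_symmetric_interval:
  fixes g :: "int \<Rightarrow> real"
  assumes "\<And>t. g (- t) = g t"
  shows "(\<Sum>k\<le>n. 2 * g (int k)) = (\<Sum>t\<in>{- int n..int n}. g t) + g 0"
proof (induction n)
  case (Suc n)
  have "{- int (Suc n)..int (Suc n)} = insert (int (Suc n)) (insert (- int (Suc n)) {- int n..int n})"
    by auto
  then show ?case using Suc assms[of "int (Suc n)"] by simp
qed simp

text \<open>
  The proof works with Abel means \<open>A j\<close> along radii \<open>r j\<close> tending to \<open>1\<close>. The upper bound for the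
  integral of \<open>f\<close> is Fatou's lemma; the lower bound is uniform integrability of the means, from the
  maximum principle.
\<close>

lemma positive_trigonometric_series_normalized:
  fixes c :: "int \<Rightarrow> complex" and f :: "real \<Rightarrow> real"
  assumes herm: "\<And>n. c (- n) = cnj (c n)"
    and pos: "\<And>T x. 0 \<le> Re (toeplitz_form c T x)"
    and conv: "\<And>x. x \<in> {-pi..pi} - {0} \<Longrightarrow>
      (\<lambda>n. \<Sum>t\<in>{- int n..int n}. Re (c t * cis (- (of_int t * x)))) \<longlonglongrightarrow> f x"
    and one: "c 0 = 1"
  shows "(f has_integral 2 * pi) {-pi..pi}"
proof -
  obtain \<mu> where "real_distribution \<mu>" and supp: "AE x in \<mu>. x \<in> {-pi..pi}"
    and char: "\<And>n. char \<mu> (real n) = c (int n)"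
    using herglotz[OF herm pos one] by metis
  interpret \<mu>: real_distribution \<mu> by fact
  interpret circ: finite_measure circ by (rule finite_measure_circ)
  define r where "r j = 1 - 1 / real (Suc (Suc j))" for j
  have r: "0 \<le> r j" "r j < 1" for j by (auto simp: r_def)
  have r_lim: "r \<longlonglongrightarrow> 1"
    unfolding r_def
    using tendsto_diff[OF tendsto_const LIMSEQ_ignore_initial_segment[OF lim_const_over_n[of 1], of 2], of 1]
    by simp
  define A where "A j = poisson_integral \<mu> (r j) UNIV" for j
  define b where "b x n = 2 * Re (c (int n) * cis (- (real n * x)))" for x n
  have A_sums: "(\<lambda>n. r j ^ n * b x n) sums (A j x + 1)" for j x
    using \<mu>.poisson_integral_sums[OF r, of j x]
    by (simp only: char A_def b_def mult.left_commute[of 2])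
  have A_nonneg: "0 \<le> A j x" for j x
    unfolding A_def by (rule \<mu>.poisson_integral_nonneg[OF r])
  have A_meas [measurable]: "A j \<in> borel_measurable borel" for j
    unfolding A_def by (rule \<mu>.poisson_integral_measurable[OF r]) simp
  have A_cont: "continuous_on UNIV (A j)" for j
    unfolding A_def using \<mu>.isCont_poisson_integral[OF r] by (simp add: continuous_on_eq_continuous_at)

  have b_sums: "b x sums (f x + 1)" if x: "x \<in> {-pi..pi} - {0}" for x
  proof -
    let ?g = "\<lambda>t. Re (c t * cis (- (of_int t * x)))"
    have g: "?g (- t) = ?g t" for t by (simp add: herm)
    have "(\<Sum>k\<le>n. b x k) = (\<Sum>t\<in>{- int n..int n}. ?g t) + 1" for n
      using sum_symmetric_interval[of ?g n, OF g] by (simp add: b_def one)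
    then show ?thesis
      unfolding sums_def_le using tendsto_add[OF conv[OF x] tendsto_const[of 1]] by simp
  qed
  have A_lim: "(\<lambda>j. A j x) \<longlonglongrightarrow> f x" if x: "x \<in> {-pi..pi} - {0}" for x
  proof -
    have "(\<lambda>j. \<Sum>n. r j ^ n * b x n) \<longlonglongrightarrow> f x + 1"
      by (rule abel_sum_tendsto[OF b_sums[OF x] r r_lim])
    then have "(\<lambda>j. A j x + 1) \<longlonglongrightarrow> f x + 1"
      using A_sums by (simp add: sums_iff)
    then show ?thesis by (simp add: tendsto_add_const_iff[of 1, simplified add.commute] add.commute)
  qed

  \<comment> \<open>At \<open>x = \<pi>\<close> the general term is, up to sign, twice the real part of \<open>c n\<close>, which therefore tends
    to \<open>0\<close>. An atom at \<open>0\<close> would make the Abel means at \<open>0\<close> grow like \<open>1 / (1 - r)\<close>.\<close>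
  have atom: "measure \<mu> {0} = 0"
  proof -
    have b0: "b 0 \<longlonglongrightarrow> 0"
    proof (rule tendsto_rabs_zero_cancel)
      have "b pi \<longlonglongrightarrow> 0"
        by (rule summable_LIMSEQ_zero, rule sums_summable, rule b_sums) simp
      then have "(\<lambda>n. \<bar>b pi n\<bar>) \<longlonglongrightarrow> 0" by (rule tendsto_rabs_zero)
      moreover have "\<bar>b pi n\<bar> = \<bar>b 0 n\<bar>" for n
        using sin_npi[of n] cos_npi[of n] by (simp add: b_def abs_mult)
      ultimately show "(\<lambda>n. \<bar>b 0 n\<bar>) \<longlonglongrightarrow> 0" by simp
    qed
    have "(\<lambda>j. (1 - r j) * (\<Sum>n. r j ^ n * b 0 n)) \<longlonglongrightarrow> 0"
      by (rule abel_mean_tendsto[OF b0 r r_lim])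
    moreover have "(1 - r j) * (\<Sum>n. r j ^ n * b 0 n) \<ge> measure \<mu> {0}" for j
    proof -
      have "measure \<mu> {0} \<le> (1 + r j) * measure \<mu> {0}"
        using r[of j] by (simp add: mult_le_cancel_right1)
      also have "\<dots> = (1 - r j) * (\<integral>y. indicator {0} y * poisson_kernel (r j) (y - 0) \<partial>\<mu>)"
      proof -
        have "(\<integral>y. indicator {0} y * poisson_kernel (r j) (y - 0) \<partial>\<mu>)
          = (\<integral>y. indicator {0} y * ((1 + r j) / (1 - r j)) \<partial>\<mu>)"
          using r[of j] by (intro Bochner_Integration.integral_cong) (auto simp: indicator_def poisson_kernel_zero)
        then show ?thesis using r[of j] by simp
      qed
      also have "\<dots> \<le> (1 - r j) * A j 0"
        using \<mu>.poisson_integral_split[OF r, of "{0}" j 0] \<mu>.poisson_integral_nonneg[OF r, of j "- {0}" 0] r[of j]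
        unfolding A_def by (intro mult_left_mono) (auto simp: poisson_integral_def)
      also have "\<dots> \<le> (1 - r j) * (\<Sum>n. r j ^ n * b 0 n)"
        using A_sums[of j 0] r[of j] by (intro mult_left_mono) (auto simp: sums_iff)
      finally show ?thesis .
    qed
    ultimately have "measure \<mu> {0} \<le> 0"
      by (intro LIMSEQ_le_const) auto
    then show ?thesis by (simp add: antisym)
  qed

  \<comment> \<open>The exceptional point \<open>0\<close> is not removed from \<open>E k\<close>, which keeps these sets compact.\<close>
  define E where "E k = {x \<in> {-pi..pi}. \<forall>j. A j x \<le> real k}" for k :: nat
  have E_compact: "compact (E k)" for k
  proof -
    have "E k = {-pi..pi} \<inter> (\<Inter>j. {x. A j x \<le> real k})" by (auto simp: E_def)
    moreover have "closed (\<Inter>j. {x. A j x \<le> real k})"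
      by (intro closed_INT ballI closed_Collect_le A_cont continuous_on_const)
    ultimately show ?thesis by (simp add: compact_Int_closed)
  qed
  have E_sets [measurable]: "E k \<in> sets borel" for k by (rule borel_compact[OF E_compact])
  have E_sub: "{-pi..pi} - {0} \<subseteq> (\<Union>k. E k)"
  proof
    fix x :: real assume x: "x \<in> {-pi..pi} - {0}"
    obtain B where B: "\<And>j. \<bar>A j x\<bar> \<le> B"
      using convergent_imp_Bseq[OF convergentI[OF A_lim[OF x]]] by (auto simp: Bseq_def)
    obtain k where "B \<le> real k" using real_arch_simple by blast
    then have "A j x \<le> real k" for j using B[of j] by linarith
    then show "x \<in> (\<Union>k. E k)" using x by (auto simp: E_def)
  qed
  have mass: "(\<lambda>k. measure \<mu> (- E k)) \<longlonglongrightarrow> 0"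
  proof -
    have "incseq E"
      by (auto simp: incseq_def E_def) (meson of_nat_le_iff order_trans)
    then have "(\<lambda>k. measure \<mu> (E k)) \<longlonglongrightarrow> measure \<mu> (\<Union>k. E k)"
      by (intro \<mu>.finite_Lim_measure_incseq) auto
    moreover have "measure \<mu> (\<Union>k. E k) = 1"
    proof -
      have "AE x in \<mu>. x \<noteq> 0"
        using atom by (intro AE_I[of _ _ "{0}"]) (auto simp: \<mu>.emeasure_eq_measure)
      with supp have "AE x in \<mu>. x \<in> (\<Union>k. E k)"
        by eventually_elim (use E_sub in auto)
      then show ?thesis by (subst \<mu>.prob_eq_1) auto
    qed
    ultimately have "(\<lambda>k. 1 - measure \<mu> (E k)) \<longlonglongrightarrow> 1 - 1"
      by (intro tendsto_intros) simp
    moreover have "measure \<mu> (- E k) = 1 - measure \<mu> (E k)" for k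
      using \<mu>.prob_compl[of "E k"] by (simp add: Compl_eq_Diff_UNIV)
    ultimately show ?thesis by simp
  qed

  define f0 where "f0 x = (if x = 0 then 0 else f x)" for x
  have sp: "space circ = {-pi..pi}" by (simp add: space_restrict_space)
  have [measurable]: "A j \<in> borel_measurable circ" for j
    by (rule measurable_restrict_space1) simp
  have f0_meas [measurable]: "f0 \<in> borel_measurable circ"
  proof (rule borel_measurable_LIMSEQ_real)
    show "(\<lambda>x. if x = 0 then 0 else A j x) \<in> borel_measurable circ" for j
      by (rule measurable_restrict_space1) simp
    show "(\<lambda>j. if x = 0 then 0 else A j x) \<longlonglongrightarrow> f0 x" if "x \<in> space circ" for x
      using A_lim[of x] that by (auto simp: f0_def sp)
  qed
  have nz: "AE x in circ. x \<noteq> 0"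
    by (subst AE_restrict_space_iff) (auto intro: AE_mp[OF AE_lborel_singleton])
  have lim0: "AE x in circ. (\<lambda>j. A j x) \<longlonglongrightarrow> f0 x"
    using nz AE_space by eventually_elim (use A_lim in \<open>auto simp: f0_def sp\<close>)
  have f0_nonneg: "AE x in circ. 0 \<le> f0 x"
    using lim0 by eventually_elim (rule LIMSEQ_le_const, auto simp: A_nonneg)
  have A_int: "integrable circ (A j)" and A_integral: "integral\<^sup>L circ (A j) = 2 * pi" for j
    unfolding A_def using \<mu>.integrable_poisson_integral[OF r, of UNIV j]
      \<mu>.integral_poisson_integral[OF r, of UNIV j] \<mu>.prob_space by simp_all

  have "(\<integral>\<^sup>+x. ennreal (f0 x) \<partial>circ) = (\<integral>\<^sup>+x. liminf (\<lambda>j. ennreal (A j x)) \<partial>circ)"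
    by (rule nn_integral_cong_AE, use lim0 in eventually_elim)
      (intro lim_imp_Liminf[symmetric] tendsto_ennrealI, simp_all)
  also have "\<dots> \<le> liminf (\<lambda>j. \<integral>\<^sup>+x. ennreal (A j x) \<partial>circ)"
    by (rule nn_integral_liminf) simp
  also have "(\<lambda>j. \<integral>\<^sup>+x. ennreal (A j x) \<partial>circ) = (\<lambda>j. ennreal (2 * pi))"
    by (simp add: nn_integral_eq_integral A_int A_nonneg A_integral)
  finally have upper: "(\<integral>\<^sup>+x. ennreal (f0 x) \<partial>circ) \<le> ennreal (2 * pi)"
    by (simp add: Liminf_const)
  have f0_int: "integrable circ f0"
    using upper f0_nonneg by (intro integrableI_nonneg) (auto intro: le_less_trans)
  have "ennreal (integral\<^sup>L circ f0) \<le> ennreal (2 * pi)"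
    using upper nn_integral_eq_integral[OF f0_int f0_nonneg] by simp
  then have le: "integral\<^sup>L circ f0 \<le> 2 * pi" by (simp add: ennreal_le_iff)

  \<comment> \<open>The truncated means converge boundedly; what truncation removes is at most the Poisson integral of
    the mass outside \<open>E k\<close>.\<close>
  have lower: "2 * pi \<le> integral\<^sup>L circ f0 + 2 * pi * measure \<mu> (- E k)" for k
  proof -
    let ?m = "\<lambda>j x. min (A j x) (4 * real k)"
    have m_int: "integrable circ (?m j)" for j
      by (rule Bochner_Integration.integrable_bound[OF A_int[of j]])
        (auto simp: A_nonneg)
    have "2 * pi \<le> integral\<^sup>L circ (?m j) + 2 * pi * measure \<mu> (- E k)" for j
    proof -
      have "2 * pi = integral\<^sup>L circ (A j)" by (simp add: A_integral)
      also have "\<dots> \<le> (\<integral>x. ?m j x + poisson_integral \<mu> (r j) (- E k) x \<partial>circ)"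
      proof (rule integral_mono[OF A_int])
        show "integrable circ (\<lambda>x. ?m j x + poisson_integral \<mu> (r j) (- E k) x)"
          by (intro Bochner_Integration.integrable_add m_int \<mu>.integrable_poisson_integral r) auto
        fix x assume "x \<in> space circ"
        then have x: "x \<in> {-pi..pi}" by (simp add: sp)
        have "poisson_integral \<mu> (r j) (E k) x \<le> 4 * real k"
          by (rule \<mu>.poisson_integral_maximum[OF r E_compact _ x]) (auto simp: E_def A_def)
        moreover have "A j x = poisson_integral \<mu> (r j) (E k) x + poisson_integral \<mu> (r j) (- E k) x"
          unfolding A_def by (rule \<mu>.poisson_integral_split[OF r]) simp
        moreover have "0 \<le> poisson_integral \<mu> (r j) (- E k) x"
          by (rule \<mu>.poisson_integral_nonneg[OF r])
        ultimately show "A j x \<le> ?m j x + poisson_integral \<mu> (r j) (- E k) x" by linarith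
      qed
      also have "\<dots> = integral\<^sup>L circ (?m j) + 2 * pi * measure \<mu> (- E k)"
        by (subst Bochner_Integration.integral_add)
          (auto intro: m_int \<mu>.integrable_poisson_integral[OF r] simp: \<mu>.integral_poisson_integral[OF r])
      finally show ?thesis .
    qed
    moreover have "(\<lambda>j. integral\<^sup>L circ (?m j)) \<longlonglongrightarrow> (\<integral>x. min (f0 x) (4 * real k) \<partial>circ)"
    proof (rule integral_dominated_convergence)
      show "integrable circ (\<lambda>x. 4 * real k)" by simp
      show "AE x in circ. (\<lambda>j. ?m j x) \<longlonglongrightarrow> min (f0 x) (4 * real k)"
        using lim0 by eventually_elim (intro tendsto_min tendsto_const)
      show "AE x in circ. norm (?m j x) \<le> 4 * real k" for j
        by (intro AE_I2) (auto simp: A_nonneg)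
    qed auto
    ultimately have "2 * pi \<le> (\<integral>x. min (f0 x) (4 * real k) \<partial>circ) + 2 * pi * measure \<mu> (- E k)"
      by (intro LIMSEQ_le_const[OF tendsto_add[OF _ tendsto_const]]) auto
    moreover have "(\<integral>x. min (f0 x) (4 * real k) \<partial>circ) \<le> integral\<^sup>L circ f0"
    proof (rule integral_mono_AE[OF _ f0_int])
      show "integrable circ (\<lambda>x. min (f0 x) (4 * real k))"
        using f0_nonneg by (intro Bochner_Integration.integrable_bound[OF f0_int]) auto
    qed auto
    ultimately show ?thesis by linarith
  qed
  have "2 * pi \<le> integral\<^sup>L circ f0 + 2 * pi * 0"
    by (rule LIMSEQ_le_const[OF tendsto_add[OF tendsto_const tendsto_mult[OF tendsto_const mass]]])
      (use lower in auto)
  with le have eq: "integral\<^sup>L circ f0 = 2 * pi" by simp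
  have "set_integrable lborel {-pi..pi} f0" "(LINT x:{-pi..pi}|lborel. f0 x) = 2 * pi"
    using f0_int eq by (simp_all add: integrable_restrict_space integral_restrict_space set_integrable_def
      set_lebesgue_integral_def)
  then have "(f0 has_integral 2 * pi) {-pi..pi}"
    using set_borel_integral_eq_integral[of "{-pi..pi}" f0] by (simp add: has_integral_iff)
  then show ?thesis
    by (rule has_integral_spike_finite[rotated 2, of _ _ _ "{0}"]) (auto simp: f0_def)
qed

text \<open>
  Adding \<open>1\<close> to the constant coefficient and to \<open>f\<close> preserves all hypotheses and makes the constant
  coefficient positive, so that it can be scaled to \<open>1\<close> even when it was \<open>0\<close> to begin with.
\<close>

theorem positive_trigonometric_series_integral:
  fixes c :: "int \<Rightarrow> complex" and f :: "real \<Rightarrow> real"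
  assumes herm: "\<And>n. c (- n) = cnj (c n)"
    and pos: "\<And>T x. 0 \<le> Re (toeplitz_form c T x)"
    and conv: "\<And>x. x \<in> {-pi..pi} - {0} \<Longrightarrow>
      (\<lambda>n. \<Sum>t\<in>{- int n..int n}. Re (c t * cis (- (of_int t * x)))) \<longlonglongrightarrow> f x"
  shows "(f has_integral 2 * pi * Re (c 0)) {-pi..pi}"
proof -
  have c0: "0 \<le> Re (c 0)" using pos[of 1 0] by (simp add: toeplitz_form_def)
  have c0_real: "c 0 = of_real (Re (c 0))" using herm[of 0] by (simp add: complex_eq_iff)
  define a where "a = Re (c 0) + 1"
  have a: "a > 0" using c0 by (simp add: a_def)
  define d where "d n = (c n + (if n = 0 then 1 else 0)) / of_real a" for n
  have "((\<lambda>x. (f x + 1) / a) has_integral 2 * pi) {-pi..pi}"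
  proof (rule positive_trigonometric_series_normalized[of d])
    show "d (- n) = cnj (d n)" for n by (simp add: d_def herm)
    show "0 \<le> Re (toeplitz_form d T x)" for T x
    proof -
      have "toeplitz_form d T x = (toeplitz_form c T x + (\<Sum>s\<in>{1..int T}. \<Sum>t\<in>{1..int T}. if t - s = 0 then 1 else 0)) / of_real a"
        unfolding toeplitz_form_def d_def sum.distrib[symmetric] sum_divide_distrib
        by (intro sum.cong refl) (auto simp: field_simps)
      also have "(\<Sum>s\<in>{1..int T}. \<Sum>t\<in>{1..int T}. if t - s = 0 then 1 else 0) = complex_of_real (real T)"
        by simp
      finally show ?thesis using pos[of T x] a by simp
    qed
    show "d 0 = 1" using a c0_real by (simp add: d_def a_def complex_eq_iff)
    fix x :: real assume x: "x \<in> {-pi..pi} - {0}"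
    have "(\<Sum>t\<in>{- int n..int n}. Re (d t * cis (- (of_int t * x)))) =
       ((\<Sum>t\<in>{- int n..int n}. Re (c t * cis (- (of_int t * x)))) + 1) / a" for n
    proof -
      have "(\<Sum>t\<in>{- int n..int n}. Re (d t * cis (- (of_int t * x)))) =
        (\<Sum>t\<in>{- int n..int n}. (Re (c t * cis (- (of_int t * x))) + (if t = 0 then 1 else 0)) / a)"
        using a by (intro sum.cong refl) (auto simp: d_def field_simps)
      then show ?thesis by (simp add: sum_divide_distrib[symmetric] sum.distrib)
    qed
    then show "(\<lambda>n. \<Sum>t\<in>{- int n..int n}. Re (d t * cis (- (of_int t * x)))) \<longlonglongrightarrow> (f x + 1) / a"
      using a by (simp only:) (intro tendsto_intros conv[OF x], simp)
  qed
  from has_integral_diff[OF has_integral_mult_left[OF this, of a] has_integral_const_real[of 1 "-pi" pi]]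
  have "(f has_integral 2 * pi * a - 2 * pi) {-pi..pi}" using a by simp
  then show ?thesis by (simp add: a_def algebra_simps)
qed

section \<open>Gauge integrability of vector-valued limits of continuous functions\<close>

text \<open>
  On a division that is fine for \<open>norm (f - g)\<close>, the Riemann sums of \<open>f\<close> and \<open>g\<close> differ by little more
  than the integral of \<open>norm (f - g)\<close>, so the Cauchy criterion passes from \<open>g\<close> to \<open>f\<close>. No separability
  of the range enters.
\<close>

lemma integrable_on_if_approximable:
  fixes f :: "real \<Rightarrow> 'b::banach"
  assumes approx: "\<And>e. e > 0 \<Longrightarrow> \<exists>g I. g integrable_on {a..b} \<and>
      ((\<lambda>x. norm (f x - g x)) has_integral I) {a..b} \<and> I < e"
  shows "f integrable_on {a..b}"
proof -
  have "f integrable_on cbox a b"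
    unfolding integrable_Cauchy
  proof (intro allI impI)
    fix e :: real assume e: "e > 0"
    obtain g I where g: "g integrable_on {a..b}" and I: "((\<lambda>x. norm (f x - g x)) has_integral I) {a..b}" "I < e / 6"
      using approx[of "e / 6"] e by auto
    from I(1) obtain \<gamma>1 where \<gamma>1: "gauge \<gamma>1"
      "\<And>\<D>. \<D> tagged_division_of {a..b} \<Longrightarrow> \<gamma>1 fine \<D> \<Longrightarrow>
        norm ((\<Sum>(x,K)\<in>\<D>. measure lborel K *\<^sub>R norm (f x - g x)) - I) < e / 6"
      using e by (auto simp: has_integral_real elim!: allE[of _ "e / 6"])
    have "e / 3 > 0" using e by simp
    moreover have "g integrable_on cbox a b" using g by simp
    ultimately have "\<exists>\<gamma>. gauge \<gamma> \<and> (\<forall>\<D>1 \<D>2. \<D>1 tagged_division_of cbox a b \<and> \<gamma> fine \<D>1 \<and>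
        \<D>2 tagged_division_of cbox a b \<and> \<gamma> fine \<D>2 \<longrightarrow>
        norm ((\<Sum>(x,K)\<in>\<D>1. measure lborel K *\<^sub>R g x) - (\<Sum>(x,K)\<in>\<D>2. measure lborel K *\<^sub>R g x)) < e / 3)"
      unfolding integrable_Cauchy by (elim allE impE)
    then obtain \<gamma>2 where \<gamma>2: "gauge \<gamma>2"
      "\<And>\<D>1 \<D>2. \<D>1 tagged_division_of {a..b} \<Longrightarrow> \<gamma>2 fine \<D>1 \<Longrightarrow> \<D>2 tagged_division_of {a..b} \<Longrightarrow> \<gamma>2 fine \<D>2 \<Longrightarrow>
        norm ((\<Sum>(x,K)\<in>\<D>1. measure lborel K *\<^sub>R g x) - (\<Sum>(x,K)\<in>\<D>2. measure lborel K *\<^sub>R g x)) < e / 3"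
      unfolding box_real by metis
    have close: "norm ((\<Sum>(x,K)\<in>\<D>. measure lborel K *\<^sub>R f x) - (\<Sum>(x,K)\<in>\<D>. measure lborel K *\<^sub>R g x)) < e / 3"
      if "\<D> tagged_division_of {a..b}" "\<gamma>1 fine \<D>" for \<D>
    proof -
      have "(\<Sum>(x,K)\<in>\<D>. measure lborel K *\<^sub>R f x) - (\<Sum>(x,K)\<in>\<D>. measure lborel K *\<^sub>R g x)
          = (\<Sum>(x,K)\<in>\<D>. measure lborel K *\<^sub>R (f x - g x))"
        by (simp add: sum_subtractf[symmetric] split_def scaleR_diff_right)
      also have "norm \<dots> \<le> (\<Sum>(x,K)\<in>\<D>. measure lborel K *\<^sub>R norm (f x - g x))"
        by (rule order_trans[OF norm_sum]) (auto intro!: sum_mono simp: split_def)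
      also have "\<dots> < e / 3" using \<gamma>1(2)[OF that] I(2) unfolding real_norm_def by linarith
      finally show ?thesis .
    qed
    show "\<exists>\<gamma>. gauge \<gamma> \<and> (\<forall>\<D>1 \<D>2. \<D>1 tagged_division_of cbox a b \<and> \<gamma> fine \<D>1 \<and>
            \<D>2 tagged_division_of cbox a b \<and> \<gamma> fine \<D>2 \<longrightarrow>
            norm ((\<Sum>(x,K)\<in>\<D>1. measure lborel K *\<^sub>R f x) - (\<Sum>(x,K)\<in>\<D>2. measure lborel K *\<^sub>R f x)) < e)"
    proof (intro exI[of _ "\<lambda>x. \<gamma>1 x \<inter> \<gamma>2 x"] conjI allI impI gauge_Int \<gamma>1(1) \<gamma>2(1))
      fix \<D>1 \<D>2
      assume "\<D>1 tagged_division_of cbox a b \<and> (\<lambda>x. \<gamma>1 x \<inter> \<gamma>2 x) fine \<D>1 \<and>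
            \<D>2 tagged_division_of cbox a b \<and> (\<lambda>x. \<gamma>1 x \<inter> \<gamma>2 x) fine \<D>2"
      then have D: "\<D>1 tagged_division_of {a..b}" "\<gamma>1 fine \<D>1" "\<gamma>2 fine \<D>1"
          "\<D>2 tagged_division_of {a..b}" "\<gamma>1 fine \<D>2" "\<gamma>2 fine \<D>2"
        by (auto simp: fine_Int)
      let ?S = "\<lambda>h \<D>. \<Sum>(x,K)\<in>\<D>. measure lborel K *\<^sub>R h x"
      have "norm ((?S f \<D>1 - ?S g \<D>1) + (?S g \<D>1 - ?S g \<D>2) - (?S f \<D>2 - ?S g \<D>2)) < e / 3 + e / 3 + e / 3"
        using close[OF D(1,2)] close[OF D(4,5)] \<gamma>2(2)[OF D(1,3,4,6)]
          norm_triangle_ineq4[of "(?S f \<D>1 - ?S g \<D>1) + (?S g \<D>1 - ?S g \<D>2)" "?S f \<D>2 - ?S g \<D>2"]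
          norm_triangle_ineq[of "?S f \<D>1 - ?S g \<D>1" "?S g \<D>1 - ?S g \<D>2"]
        by linarith
      then show "norm (?S f \<D>1 - ?S f \<D>2) < e" by simp
    qed
  qed
  then show ?thesis by simp
qed

text \<open>
  The radial retraction onto the ball of radius \<open>k\<close>.
\<close>

definition clamp_norm :: "real \<Rightarrow> 'b::real_normed_vector \<Rightarrow> 'b" where
  "clamp_norm k v = (k / max k (norm v)) *\<^sub>R v"

lemma continuous_clamp_norm:
  assumes "k > 0" "continuous_on S f"
  shows "continuous_on S (\<lambda>x. clamp_norm k (f x))"
  unfolding clamp_norm_def using assms by (intro continuous_intros) (auto simp: max_def)

lemma norm_clamp_norm_le: "k > 0 \<Longrightarrow> norm (clamp_norm k v) \<le> k"
  by (auto simp: clamp_norm_def field_simps max_def)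

lemma clamp_norm_id: "k > 0 \<Longrightarrow> norm v \<le> k \<Longrightarrow> clamp_norm k v = v"
  by (simp add: clamp_norm_def max_def)

lemma norm_diff_clamp_norm_le: 
  assumes "k > 0" shows "norm (v - clamp_norm k v) \<le> norm v"
proof -
  have "v - clamp_norm k v = (1 - k / max k (norm v)) *\<^sub>R v"
    by (simp add: clamp_norm_def scaleR_diff_left)
  moreover have "0 \<le> k / max k (norm v)" "k / max k (norm v) \<le> 1"
    using assms divide_le_eq_1_pos[of "max k (norm v)" k] by (simp_all add: less_max_iff_disj)
  ultimately show ?thesis by (simp add: mult_left_le_one_le)
qed

text \<open>
  All measurability is that of the real functions \<open>norm (F - g)\<close> with \<open>g\<close> continuous, which are limits
  of continuous functions. Dominated convergence is used twice: clamping \<open>F\<close> to a large ball changes it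
  little in mean, and the clamped approximants, being uniformly bounded, converge in mean to the clamped
  \<open>F\<close>.
\<close>

lemma pointwise_limit_of_continuous_integrable_on:
  fixes F :: "real \<Rightarrow> 'b::banach"
  assumes cont: "\<And>n. continuous_on {a..b} (S n)"
    and lim: "\<And>x. x \<in> {a..b} - {p} \<Longrightarrow> (\<lambda>n. S n x) \<longlonglongrightarrow> F x"
    and fin: "(\<integral>\<^sup>+x\<in>{a..b}. ennreal (norm (F x)) \<partial>lborel) < \<infinity>"
  shows "F integrable_on {a..b}"
proof -
  let ?L = "restrict_space lborel {a..b}"
  have sp: "space ?L = {a..b}" by (simp add: space_restrict_space)
  interpret L: finite_measure ?L
    by (rule finite_measureI) (simp add: emeasure_restrict_space sp emeasure_lborel_Icc_eq)
  \<comment> \<open>Redefining \<open>F\<close> at \<open>p\<close> makes it a limit at every point, hence measurable.\<close>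
  define G where "G x = (if x = p then 0 else F x)" for x
  have meas_cont: "h \<in> borel_measurable ?L" if "continuous_on {a..b} h" for h :: "real \<Rightarrow> real"
    using borel_measurable_continuous_on_restrict[OF that]
    by (simp cong: measurable_cong_sets add: sets_restrict_space_cong[OF sets_lborel])
  have if_meas: "(\<lambda>x. if x = p then c else h x) \<in> borel_measurable ?L" if "h \<in> borel_measurable ?L" for h and c :: real
  proof (rule measurable_If[OF _ that])
    have "{x \<in> space ?L. x = p} = {a..b} \<inter> {p}" by (auto simp: sp)
    then show "{x \<in> space ?L. x = p} \<in> sets ?L"
      by (metis sets_restrict_space image_eqI borel_singleton sets.empty_sets sets_lborel)
  qed simp
  have G_lim: "(\<lambda>n. if x = p then 0 else S n x) \<longlonglongrightarrow> G x" if "x \<in> {a..b}" for x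
    using lim[of x] that by (simp add: G_def)
  have meas: "(\<lambda>x. norm (G x - g x)) \<in> borel_measurable ?L" if g: "continuous_on {a..b} g" for g
  proof (rule borel_measurable_LIMSEQ_real)
    show "(\<lambda>x. norm ((if x = p then 0 else S n x) - g x)) \<in> borel_measurable ?L" for n
    proof -
      have "(\<lambda>x. if x = p then norm (g p) else norm (S n x - g x)) \<in> borel_measurable ?L"
        by (intro if_meas meas_cont continuous_intros cont g)
      also have "(\<lambda>x. if x = p then norm (g p) else norm (S n x - g x)) = (\<lambda>x. norm ((if x = p then 0 else S n x) - g x))"
        by auto
      finally show ?thesis .
    qed
    show "(\<lambda>n. norm ((if x = p then 0 else S n x) - g x)) \<longlonglongrightarrow> norm (G x - g x)" if "x \<in> space ?L" for x
      using that by (intro tendsto_intros G_lim) (simp add: sp)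
  qed
  have normG: "(\<lambda>x. norm (G x)) \<in> borel_measurable ?L"
    using meas[of "\<lambda>_. 0"] by simp
  have normG_int: "integrable ?L (\<lambda>x. norm (G x))"
  proof (rule integrableI_bounded[OF normG])
    have "(\<integral>\<^sup>+x. ennreal (norm (norm (G x))) \<partial>?L) = (\<integral>\<^sup>+x\<in>{a..b}. ennreal (norm (G x)) \<partial>lborel)"
      by (subst nn_integral_restrict_space) auto
    also have "\<dots> \<le> (\<integral>\<^sup>+x\<in>{a..b}. ennreal (norm (F x)) \<partial>lborel)"
      by (intro nn_integral_mono) (auto simp: G_def indicator_def)
    finally show "(\<integral>\<^sup>+x. ennreal (norm (norm (G x))) \<partial>?L) < \<infinity>" using fin by simp
  qed
  define C where "C k v = clamp_norm (real (Suc k)) v" for k and v :: 'b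
  have C_cont: "continuous_on {a..b} (\<lambda>x. C k (S n x))" for k n
    unfolding C_def by (intro continuous_clamp_norm cont) simp
  have C_isCont: "isCont (C k) v" for k v
    using continuous_clamp_norm[of "real (Suc k)" UNIV "\<lambda>x::'b. x"]
    by (simp add: C_def[abs_def] continuous_on_eq_continuous_at)
  have C_meas: "(\<lambda>x. norm (G x - C k (G x))) \<in> borel_measurable ?L" for k
  proof (rule borel_measurable_LIMSEQ_real)
    show "(\<lambda>x. norm (G x - C k (if x = p then 0 else S n x))) \<in> borel_measurable ?L" for n
    proof -
      have "(\<lambda>x. if x = p then norm (G p - C k 0) else norm (G x - C k (S n x))) \<in> borel_measurable ?L"
        by (intro if_meas meas C_cont)
      also have "(\<lambda>x. if x = p then norm (G p - C k 0) else norm (G x - C k (S n x))) = (\<lambda>x. norm (G x - C k (if x = p then 0 else S n x)))"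
        by auto
      finally show ?thesis .
    qed
    show "(\<lambda>n. norm (G x - C k (if x = p then 0 else S n x))) \<longlonglongrightarrow> norm (G x - C k (G x))" if "x \<in> space ?L" for x
      using that by (intro tendsto_intros isCont_tendsto_compose[OF C_isCont] G_lim) (simp add: sp)
  qed
  have C_le: "norm (v - C k v) \<le> norm v" for k v
    unfolding C_def by (rule norm_diff_clamp_norm_le) simp
  have bound: "norm (G x - C k (S n x)) \<le> norm (G x) + real (Suc k)" for x k n
  proof -
    have "norm (G x - C k (S n x)) \<le> norm (G x) + norm (C k (S n x))" by (rule norm_triangle_ineq4)
    also have "norm (C k (S n x)) \<le> real (Suc k)" unfolding C_def by (rule norm_clamp_norm_le) simp
    finally show ?thesis by simp
  qed
  have trunc: "(\<lambda>k. \<integral>x. norm (G x - C k (G x)) \<partial>?L) \<longlonglongrightarrow> (\<integral>x. 0 \<partial>?L)"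
  proof (rule integral_dominated_convergence[OF _ C_meas normG_int])
    show "AE x in ?L. (\<lambda>k. norm (G x - C k (G x))) \<longlonglongrightarrow> 0"
    proof (intro AE_I2)
      fix x
      obtain K where K: "norm (G x) \<le> real K" using real_arch_simple by blast
      have "norm (G x - C k (G x)) = 0" if "k \<ge> K" for k
        using K that unfolding C_def by (subst clamp_norm_id) auto
      then show "(\<lambda>k. norm (G x - C k (G x))) \<longlonglongrightarrow> 0"
        by (intro tendsto_eventually) (auto simp: eventually_sequentially)
    qed
  qed (use C_le in auto)
  have G_int: "G integrable_on {a..b}"
  proof (rule integrable_on_if_approximable)
    fix e :: real assume e: "e > 0"
    then obtain k where k: "(\<integral>x. norm (G x - C k (G x)) \<partial>?L) < e"
      using order_tendstoD(2)[OF trunc, of e] by (auto simp: eventually_sequentially)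
    have "(\<lambda>n. \<integral>x. norm (G x - C k (S n x)) \<partial>?L) \<longlonglongrightarrow> (\<integral>x. norm (G x - C k (G x)) \<partial>?L)"
    proof (rule integral_dominated_convergence[OF C_meas meas[OF C_cont]])
      show "integrable ?L (\<lambda>x. norm (G x) + real (Suc k))"
        using normG_int by simp
      have "AE x in lborel. x \<noteq> p" by (rule AE_lborel_singleton)
      then have "AE x in ?L. x \<noteq> p"
        by (subst AE_restrict_space_iff) auto
      then show "AE x in ?L. (\<lambda>n. norm (G x - C k (S n x))) \<longlonglongrightarrow> norm (G x - C k (G x))"
        using AE_space
      proof eventually_elim
        case (elim x)
        then show ?case
          using G_lim[of x] by (intro tendsto_intros isCont_tendsto_compose[OF C_isCont]) (simp add: sp)
      qed
      show "AE x in ?L. norm (norm (G x - C k (S n x))) \<le> norm (G x) + real (Suc k)" for n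
        using bound by (intro AE_I2) simp
    qed
    from order_tendstoD(2)[OF this k] obtain n where n: "(\<integral>x. norm (G x - C k (S n x)) \<partial>?L) < e"
      by (auto simp: eventually_sequentially)
    have "integrable ?L (\<lambda>x. norm (G x - C k (S n x)))"
    proof (rule Bochner_Integration.integrable_bound[of _ "\<lambda>x. norm (G x) + real (Suc k)"])
      show "integrable ?L (\<lambda>x. norm (G x) + real (Suc k))" using normG_int by simp
      show "AE x in ?L. norm (norm (G x - C k (S n x))) \<le> norm (norm (G x) + real (Suc k))"
        using bound[of _ k n] by (intro AE_I2) (auto intro: order_trans[OF _ abs_ge_self])
    qed (rule meas[OF C_cont])
    then have "set_integrable lborel {a..b} (\<lambda>x. norm (G x - C k (S n x)))"
      by (simp add: integrable_restrict_space set_integrable_def)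
    from set_borel_integral_eq_integral[OF this]
    have "((\<lambda>x. norm (G x - C k (S n x))) has_integral (LINT x:{a..b}|lborel. norm (G x - C k (S n x)))) {a..b}"
      by (simp add: has_integral_iff)
    also have "(LINT x:{a..b}|lborel. norm (G x - C k (S n x))) = (\<integral>x. norm (G x - C k (S n x)) \<partial>?L)"
      by (simp add: integral_restrict_space set_lebesgue_integral_def)
    finally show "\<exists>g I. g integrable_on {a..b} \<and> ((\<lambda>x. norm (G x - g x)) has_integral I) {a..b} \<and> I < e"
      using n integrable_continuous_real[OF C_cont[of k n]] by blast
  qed
  show ?thesis
    by (rule integrable_spike_finite[OF _ _ G_int, of "{p}"]) (auto simp: G_def)
qed

section \<open>Complexified operators\<close>

lemma cinner_cscale_left: "cinner (cscale c x) y = c * cinner x y"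
  by (simp add: cinner_def cscale_def complex_eq_iff inner_simps algebra_simps)

lemma cinner_commute: "cinner y x = cnj (cinner x y)"
  by (simp add: cinner_def complex_eq_iff inner_commute)

lemma inner_eq_Re_cinner: "inner x y = Re (cinner x y)"
  by (simp add: cinner_def inner_prod_def)

lemma cinner_add_left: "cinner (x + y) z = cinner x z + cinner y z"
  by (simp add: cinner_def complex_eq_iff inner_simps)

lemma cinner_scaleR_left: "cinner (r *\<^sub>R x) y = of_real r * cinner x y"
  by (simp add: cinner_def complex_eq_iff inner_simps algebra_simps)

lemma cinner_sum_left: "cinner (\<Sum>i\<in>I. x i) y = (\<Sum>i\<in>I. cinner (x i) y)"
  by (induction I rule: infinite_finite_induct) (auto simp: cinner_add_left, auto simp: cinner_def complex_eq_iff)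

lemma cscale_cscale: "cscale a (cscale b z) = cscale (a * b) z"
  by (simp add: cscale_def algebra_simps)

lemma cscale_add_left: "cscale (a + b) z = cscale a z + cscale b z"
  by (simp add: cscale_def algebra_simps)

lemma bounded_linear_cscale_left: "bounded_linear (\<lambda>c. cscale c (z :: 'h::real_inner cplx))"
  by (rule bounded_linear_intro[of _ "norm z"])
    (simp_all add: cscale_add_left norm_cscale, simp add: cscale_def algebra_simps)

lemma conjugate_conjugate: "conjugate (conjugate z) = z"
  by (simp add: conjugate_def)

lemma cscale_op_diff_le:
  "norm (cscale_op a A - cscale_op b A) \<le> cmod (a - b) * norm A"
proof (rule norm_blinfun_bound)
  fix z
  have "blinfun_apply (cscale_op a A - cscale_op b A) z = cscale (a - b) (blinfun_apply A z)"
    by (simp add: blinfun.diff_left cscale_def algebra_simps)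
  then show "norm (blinfun_apply (cscale_op a A - cscale_op b A) z) \<le> cmod (a - b) * norm A * norm z"
    by (simp add: norm_cscale mult.assoc mult_left_mono norm_blinfun)
qed simp

lemma continuous_cscale_op:
  fixes A :: "'h::real_inner cop" and f :: "real \<Rightarrow> complex"
  assumes "continuous_on S f"
  shows "continuous_on S (\<lambda>x. cscale_op (f x) A)"
proof -
  have "bounded_linear (\<lambda>c. cscale_op c A)"
  proof (rule bounded_linear_intro)
    show "norm (cscale_op c A) \<le> norm c * norm A" for c
      using cscale_op_diff_le[of c A 0]
      by (simp add: blinfun_eqI[of "cscale_op 0 A" 0] cscale_def zero_blinfun.rep_eq zero_prod_def)
  qed (auto intro!: blinfun_eqI simp: blinfun.add_left blinfun.scaleR_left cscale_def algebra_simps)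
  from bounded_linear.continuous_on[OF this assms] show ?thesis .
qed

lemma inner_sum_cscale_op:
  fixes A :: "int \<Rightarrow> 'h::real_inner cop"
  shows "inner (blinfun_apply (\<Sum>t\<in>I. cscale_op (e t) (A t)) z) y = (\<Sum>t\<in>I. Re (e t * cinner (blinfun_apply (A t) z) y))"
  by (simp add: inner_eq_Re_cinner blinfun.sum_left cinner_sum_left cinner_cscale_left)

text \<open>
  Expand the quadratic form at \<open>x + D x\<close>.
\<close>

lemma symmetric_blinfun_eq_0:
  fixes D :: "'a::real_inner \<Rightarrow>\<^sub>L 'a"
  assumes sym: "\<And>x y. inner (blinfun_apply D x) y = inner x (blinfun_apply D y)"
    and quad: "\<And>x. inner (blinfun_apply D x) x = 0"
  shows "D = 0"
proof (rule blinfun_eqI)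
  fix x
  let ?y = "blinfun_apply D x"
  have "0 = inner (blinfun_apply D (x + ?y)) (x + ?y)" by (simp only: quad)
  also have "\<dots> = inner ?y x + inner ?y ?y + (inner (blinfun_apply D ?y) x + inner (blinfun_apply D ?y) ?y)"
    by (simp only: blinfun.add_right inner_add_left inner_add_right add.assoc)
  also have "\<dots> = 2 * inner ?y ?y"
    unfolding quad sym[of ?y x] by simp
  finally show "blinfun_apply D x = blinfun_apply 0 x" by simp
qed

section \<open>Covariances, the mean periodogram and the spectral density\<close>

text \<open>
  The coefficients of the scalar trigonometric series to which the spectral density reduces when it is
  tested on \<open>z\<close>.
\<close>

definition quadratic_autocov ::
  "'w measure \<Rightarrow> (int \<Rightarrow> 'w \<Rightarrow> 'h::{real_inner,banach,second_countable_topology}) \<Rightarrow> 'h cplx \<Rightarrow> int \<Rightarrow> complex" where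
  "quadratic_autocov M X z t = cinner (blinfun_apply (complexify (autocov M X t)) z) z"

context
  fixes M :: "'w measure" and X :: "int \<Rightarrow> 'w \<Rightarrow> 'h::{real_inner,banach,second_countable_topology}"
  assumes meas: "\<And>t. X t \<in> borel_measurable M"
    and stat: "strictly_stationary M X"
    and sq: "integrable M (\<lambda>w. (norm (X 0 w))\<^sup>2)"
begin

lemma integrable_norm_square: "integrable M (\<lambda>w. (norm (X t w))\<^sup>2)"
  using stationary_integrals(1)[OF meas stat, of "\<lambda>x y. (norm x)\<^sup>2" 0 t 0] sq
  by (simp add: borel_measurable_continuous_onI continuous_intros)

lemma integrable_cross_product: "integrable M (\<lambda>w. inner (X s w) g *\<^sub>R X t w)"
proof (rule Bochner_Integration.integrable_bound)
  note [measurable] = meas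
  let ?B = "\<lambda>w. (norm (X s w))\<^sup>2 + (norm (X t w))\<^sup>2"
  show "integrable M (\<lambda>w. ?B w * norm g)" by (intro integrable_mult_left Bochner_Integration.integrable_add integrable_norm_square)
  show "(\<lambda>w. inner (X s w) g *\<^sub>R X t w) \<in> borel_measurable M" by measurable
  show "AE w in M. norm (inner (X s w) g *\<^sub>R X t w) \<le> norm (?B w * norm g)"
  proof (intro AE_I2)
    fix w
    have "norm (inner (X s w) g *\<^sub>R X t w) \<le> (norm (X s w) * norm (X t w)) * norm g"
      using mult_right_mono[OF Cauchy_Schwarz_ineq2[of "X s w" g], of "norm (X t w)"]
      by (simp add: mult_ac)
    also have "norm (X s w) * norm (X t w) \<le> ?B w"
      using sum_squares_bound[of "norm (X s w)" "norm (X t w)"]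
        mult_nonneg_nonneg[OF norm_ge_zero[of "X s w"] norm_ge_zero[of "X t w"]] by linarith
    finally show "norm (inner (X s w) g *\<^sub>R X t w) \<le> norm (?B w * norm g)"
      by (simp add: mult_right_mono)
  qed
qed

lemma integral_cross_product: "(\<integral>w. inner (X s w) g *\<^sub>R X t w \<partial>M) = blinfun_apply (autocov M X (t - s)) g"
proof -
  have "inner (\<integral>w. inner (X s w) g *\<^sub>R X t w \<partial>M) h = inner (blinfun_apply (autocov M X (t - s)) g) h" for h
  proof -
    have "inner (\<integral>w. inner (X s w) g *\<^sub>R X t w \<partial>M) h = (\<integral>w. inner (inner (X s w) g *\<^sub>R X t w) h \<partial>M)"
      by (rule integral_inner_left[symmetric]) (rule integrable_cross_product)
    also have "\<dots> = (\<integral>w. inner (X (s + (t - s)) w) h * inner (X s w) g \<partial>M)"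
      by (simp add: mult.commute)
    also have "\<dots> = inner (blinfun_apply (autocov M X (t - s)) g) h"
      by (rule inner_autocov[OF meas stat sq, symmetric])
    finally show ?thesis .
  qed
  then show ?thesis using vector_eq_rdot by blast
qed

lemma inner_autocov_minus:
  "inner (blinfun_apply (autocov M X (- t)) g) h = inner g (blinfun_apply (autocov M X t) h)"
  using inner_autocov[OF meas stat sq, of "- t" g h t] inner_autocov[OF meas stat sq, of t h g 0]
  by (simp add: inner_commute mult.commute)

lemma cinner_complexify_autocov_minus:
  "cinner (blinfun_apply (complexify (autocov M X (- t))) z) y =
   cnj (cinner (blinfun_apply (complexify (autocov M X t)) y) z)"
  by (simp add: cinner_def complex_eq_iff inner_autocov_minus inner_commute[of "fst z"] inner_commute[of "snd z"])

lemma periodogram_apply: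
  "blinfun_apply (periodogram X T x w) z =
    (1 / (2 * pi * real T)) *\<^sub>R (\<Sum>s\<in>{1..int T}. \<Sum>t\<in>{1..int T}.
       cscale (cis (- (of_int (t - s) * x))) (inner (X s w) (fst z) *\<^sub>R X t w, inner (X s w) (snd z) *\<^sub>R X t w))"
proof -
  define e where "e t = cis (- (of_int t * x))" for t :: int
  define k where "k = 1 / sqrt (2 * pi * real T)"
  have kk: "k * k = 1 / (2 * pi * real T)" by (simp add: k_def)
  have fdft: "fdft X T x w = k *\<^sub>R (\<Sum>t\<in>{1..int T}. cscale (e t) (emb (X t w)))"
    by (simp add: fdft_def k_def e_def cis_conv_exp mult_ac)
  have "cinner z (fdft X T x w) = cnj (cinner (fdft X T x w) z)" by (rule cinner_commute)
  also have "\<dots> = k * (\<Sum>s\<in>{1..int T}. cnj (e s) * cinner z (emb (X s w)))"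
    by (simp add: fdft cinner_scaleR_left cinner_sum_left cinner_cscale_left cinner_commute[of z])
  finally have ci: "cinner z (fdft X T x w) = k * (\<Sum>s\<in>{1..int T}. cnj (e s) * cinner z (emb (X s w)))" .
  interpret R: bounded_linear "cscale c :: 'h cplx \<Rightarrow> 'h cplx" for c by (rule bounded_linear_cscale)
  interpret L: bounded_linear "\<lambda>c. cscale c (v :: 'h cplx)" for v by (rule bounded_linear_cscale_left)
  have "blinfun_apply (periodogram X T x w) z = cscale (cinner z (fdft X T x w)) (fdft X T x w)"
    by (simp add: periodogram_def conjugate_conjugate)
  also have "\<dots> = (k * k) *\<^sub>R (\<Sum>s\<in>{1..int T}. \<Sum>t\<in>{1..int T}. cscale (cnj (e s) * cinner z (emb (X s w))) (cscale (e t) (emb (X t w))))"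
    unfolding ci by (subst fdft) (simp add: R.scaleR R.sum L.sum L.scaleR scaleR_conv_of_real[symmetric] scaleR_sum_right flip: scaleR_conv_of_real, rule sum.swap)
  also have "\<dots> = (k * k) *\<^sub>R (\<Sum>s\<in>{1..int T}. \<Sum>t\<in>{1..int T}.
       cscale (cis (- (of_int (t - s) * x))) (inner (X s w) (fst z) *\<^sub>R X t w, inner (X s w) (snd z) *\<^sub>R X t w))"
  proof (intro arg_cong2[where f = scaleR] refl sum.cong)
    fix s t
    have "cscale (cinner z (emb (X s w))) (emb (X t w)) = (inner (X s w) (fst z) *\<^sub>R X t w, inner (X s w) (snd z) *\<^sub>R X t w)"
      by (simp add: cscale_def cinner_def emb_def inner_commute)
    moreover have "e t * cnj (e s) = cis (- (of_int (t - s) * x))"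
      by (simp add: e_def cis_cnj cis_mult algebra_simps)
    moreover have "cscale (cnj (e s) * cinner z (emb (X s w))) (cscale (e t) (emb (X t w))) =
        cscale (e t * cnj (e s)) (cscale (cinner z (emb (X s w))) (emb (X t w)))"
      by (simp only: cscale_cscale mult_ac)
    ultimately show "cscale (cnj (e s) * cinner z (emb (X s w))) (cscale (e t) (emb (X t w))) =
       cscale (cis (- (of_int (t - s) * x))) (inner (X s w) (fst z) *\<^sub>R X t w, inner (X s w) (snd z) *\<^sub>R X t w)"
      by (simp only:)
  qed
  finally show ?thesis by (simp add: kk)
qed

lemma integrable_pair_scaled:
  "integrable M (\<lambda>w. (inner (X s w) g *\<^sub>R X t w, inner (X s w) h *\<^sub>R X t w))"
  and integral_pair_scaled:
  "(\<integral>w. (inner (X s w) g *\<^sub>R X t w, inner (X s w) h *\<^sub>R X t w) \<partial>M) =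
     blinfun_apply (complexify (autocov M X (t - s))) (g, h)"
proof -
  have 1: "bounded_linear (\<lambda>x :: 'h. (x, 0 :: 'h))" and 2: "bounded_linear (\<lambda>x :: 'h. (0 :: 'h, x))"
    by (auto intro!: bounded_linear_Pair bounded_linear_ident bounded_linear_zero)
  have "has_bochner_integral M
     (\<lambda>w. (inner (X s w) g *\<^sub>R X t w, 0 :: 'h) + (0 :: 'h, inner (X s w) h *\<^sub>R X t w))
     ((blinfun_apply (autocov M X (t - s)) g, 0) + (0, blinfun_apply (autocov M X (t - s)) h))"
    by (intro has_bochner_integral_add has_bochner_integral_bounded_linear[OF 1]
      has_bochner_integral_bounded_linear[OF 2])
      (simp_all add: has_bochner_integral_iff integrable_cross_product integral_cross_product)
  then show "integrable M (\<lambda>w. (inner (X s w) g *\<^sub>R X t w, inner (X s w) h *\<^sub>R X t w))"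
    "(\<integral>w. (inner (X s w) g *\<^sub>R X t w, inner (X s w) h *\<^sub>R X t w) \<partial>M) =
     blinfun_apply (complexify (autocov M X (t - s))) (g, h)"
    by (simp_all add: has_bochner_integral_iff)
qed

lemma mean_periodogram_apply:
  "blinfun_apply (mean_periodogram M X T x) z = (\<integral>w. blinfun_apply (periodogram X T x w) z \<partial>M)"
  unfolding mean_periodogram_def
proof (rule op_expectation_apply)
  note [measurable] = meas
  let ?B = "\<lambda>w. (1 / (2 * pi * real T)) * (\<Sum>s\<in>{1..int T}. \<Sum>t\<in>{1..int T}. 2 * ((norm (X s w))\<^sup>2 + (norm (X t w))\<^sup>2))"
  show "(\<lambda>w. blinfun_apply (periodogram X T x w) z) \<in> borel_measurable M" for z
    unfolding periodogram_apply cscale_def fst_conv snd_conv by measurable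
  show "integrable M ?B"
    by (intro integrable_mult_right Bochner_Integration.integrable_sum Bochner_Integration.integrable_add integrable_norm_square)
  show "norm (periodogram X T x w) \<le> ?B w" for w
  proof (rule norm_blinfun_bound)
    show "0 \<le> ?B w" by (intro mult_nonneg_nonneg sum_nonneg) auto
    fix z
    have le: "norm (cscale (cis (- (of_int (t - s) * x))) (inner (X s w) (fst z) *\<^sub>R X t w, inner (X s w) (snd z) *\<^sub>R X t w))
        \<le> 2 * ((norm (X s w))\<^sup>2 + (norm (X t w))\<^sup>2) * norm z" for s t
    proof -
      have *: "norm (inner (X s w) v *\<^sub>R X t w) \<le> ((norm (X s w))\<^sup>2 + (norm (X t w))\<^sup>2) * norm z"
        if v: "norm v \<le> norm z" for v
      proof -
        have "norm (inner (X s w) v *\<^sub>R X t w) \<le> (norm (X s w) * norm v) * norm (X t w)"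
          using mult_right_mono[OF Cauchy_Schwarz_ineq2[of "X s w" v], of "norm (X t w)"] by simp
        also have "\<dots> = (norm (X s w) * norm (X t w)) * norm v" by simp
        also have "\<dots> \<le> ((norm (X s w))\<^sup>2 + (norm (X t w))\<^sup>2) * norm z"
        proof (intro mult_mono v)
          show "norm (X s w) * norm (X t w) \<le> (norm (X s w))\<^sup>2 + (norm (X t w))\<^sup>2"
            using sum_squares_bound[of "norm (X s w)" "norm (X t w)"]
              mult_nonneg_nonneg[OF norm_ge_zero[of "X s w"] norm_ge_zero[of "X t w"]] by linarith
        qed auto
        finally show ?thesis .
      qed
      have "norm (inner (X s w) (fst z) *\<^sub>R X t w, inner (X s w) (snd z) *\<^sub>R X t w)
          \<le> norm (inner (X s w) (fst z) *\<^sub>R X t w) + norm (inner (X s w) (snd z) *\<^sub>R X t w)"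
        by (rule norm_Pair_le)
      then show ?thesis
        using *[of "fst z"] *[of "snd z"] norm_fst_le[of "fst z" "snd z"] norm_snd_le[of "snd z" "fst z"]
        by (simp add: norm_cscale algebra_simps)
    qed
    have "norm (blinfun_apply (periodogram X T x w) z) \<le>
        (1 / (2 * pi * real T)) * (\<Sum>s\<in>{1..int T}. \<Sum>t\<in>{1..int T}. 2 * ((norm (X s w))\<^sup>2 + (norm (X t w))\<^sup>2) * norm z)"
      unfolding periodogram_apply norm_scaleR
    proof (rule mult_mono)
      show "norm (\<Sum>s\<in>{1..int T}. \<Sum>t\<in>{1..int T}. cscale (cis (- (of_int (t - s) * x)))
          (inner (X s w) (fst z) *\<^sub>R X t w, inner (X s w) (snd z) *\<^sub>R X t w))
        \<le> (\<Sum>s\<in>{1..int T}. \<Sum>t\<in>{1..int T}. 2 * ((norm (X s w))\<^sup>2 + (norm (X t w))\<^sup>2) * norm z)"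
        by (intro sum_norm_le le)
    qed auto
    also have "\<dots> = ?B w * norm z" by (simp add: sum_distrib_right mult.assoc)
    finally show "norm (blinfun_apply (periodogram X T x w) z) \<le> ?B w * norm z" .
  qed
qed

lemma integrable_cscale_pair:
  "integrable M (\<lambda>w. cscale c (inner (X s w) g *\<^sub>R X t w, inner (X s w) h *\<^sub>R X t w))"
  using integrable_bounded_linear[where T = "cscale c", OF bounded_linear_cscale
    integrable_pair_scaled[where s = s and g = g and t = t and h = h]] .

lemma integral_cscale_pair:
  "(\<integral>w. cscale c (inner (X s w) g *\<^sub>R X t w, inner (X s w) h *\<^sub>R X t w) \<partial>M) =
      cscale c (blinfun_apply (complexify (autocov M X (t - s))) (g, h))"
  unfolding integral_pair_scaled[symmetric]
  using integral_bounded_linear[where T = "cscale c", OF bounded_linear_cscale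
    integrable_pair_scaled[where s = s and g = g and t = t and h = h]] .

text \<open>
  The double sum is kept, rather than collected by lags, because it exhibits the mean periodogram as a
  Toeplitz form.
\<close>

lemma mean_periodogram_eq:
  "mean_periodogram M X T x = (1 / (2 * pi * real T)) *\<^sub>R (\<Sum>s\<in>{1..int T}. \<Sum>t\<in>{1..int T}.
     cscale_op (cis (- (of_int (t - s) * x))) (complexify (autocov M X (t - s))))"
proof (rule blinfun_eqI)
  fix z
  let ?f = "\<lambda>s t w. cscale (cis (- (of_int (t - s) * x))) (inner (X s w) (fst z) *\<^sub>R X t w, inner (X s w) (snd z) *\<^sub>R X t w)"
  have "(\<integral>w. blinfun_apply (periodogram X T x w) z \<partial>M) =
      (1 / (2 * pi * real T)) *\<^sub>R (\<integral>w. (\<Sum>s\<in>{1..int T}. \<Sum>t\<in>{1..int T}. ?f s t w) \<partial>M)"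
    unfolding periodogram_apply by (rule Bochner_Integration.integral_scaleR_right)
  also have "(\<integral>w. (\<Sum>s\<in>{1..int T}. \<Sum>t\<in>{1..int T}. ?f s t w) \<partial>M) = (\<Sum>s\<in>{1..int T}. \<integral>w. (\<Sum>t\<in>{1..int T}. ?f s t w) \<partial>M)"
    by (rule Bochner_Integration.integral_sum, rule Bochner_Integration.integrable_sum, rule integrable_cscale_pair)
  also have "\<dots> = (\<Sum>s\<in>{1..int T}. \<Sum>t\<in>{1..int T}. \<integral>w. ?f s t w \<partial>M)"
    by (rule sum.cong[OF refl], rule Bochner_Integration.integral_sum, rule integrable_cscale_pair)
  finally show "blinfun_apply (mean_periodogram M X T x) z = blinfun_apply ((1 / (2 * pi * real T)) *\<^sub>R (\<Sum>s\<in>{1..int T}. \<Sum>t\<in>{1..int T}.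
     cscale_op (cis (- (of_int (t - s) * x))) (complexify (autocov M X (t - s))))) z"
    by (simp only: mean_periodogram_apply integral_cscale_pair blinfun.scaleR_left blinfun.sum_left
      cscale_op_apply prod.collapse)
qed

lemma integrable_periodogram_apply: "integrable M (\<lambda>w. blinfun_apply (periodogram X T x w) z)"
  unfolding periodogram_apply
  by (rule integrable_scaleR_right, rule Bochner_Integration.integrable_sum,
      rule Bochner_Integration.integrable_sum, rule integrable_cscale_pair)

text \<open>
  The source of both positivity and self-adjointness of the mean periodogram.
\<close>

lemma inner_mean_periodogram_eq_expectation:
  "inner (blinfun_apply (mean_periodogram M X T x) z) y =
    (\<integral>w. Re (cinner z (fdft X T x w) * cnj (cinner y (fdft X T x w))) \<partial>M)"
proof -
  have "inner (blinfun_apply (periodogram X T x w) z) y = Re (cinner z (fdft X T x w) * cnj (cinner y (fdft X T x w)))" for w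
  proof -
    have "blinfun_apply (periodogram X T x w) z = cscale (cinner z (fdft X T x w)) (fdft X T x w)"
      by (simp add: periodogram_def conjugate_conjugate)
    then have "inner (blinfun_apply (periodogram X T x w) z) y = Re (cinner z (fdft X T x w) * cinner (fdft X T x w) y)"
      by (simp only: inner_eq_Re_cinner cinner_cscale_left)
    also have "cinner (fdft X T x w) y = cnj (cinner y (fdft X T x w))" by (rule cinner_commute)
    finally show ?thesis .
  qed
  then show ?thesis
    using integral_inner_left[where c = y, OF integrable_periodogram_apply[of T x z]] by (simp only: mean_periodogram_apply)
qed

lemma inner_mean_periodogram_nonneg: "0 \<le> inner (blinfun_apply (mean_periodogram M X T x) z) z"
  unfolding inner_mean_periodogram_eq_expectation complex_norm_square[symmetric] by simp

lemma inner_mean_periodogram_commute: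
  "inner (blinfun_apply (mean_periodogram M X T x) z) y = inner z (blinfun_apply (mean_periodogram M X T x) y)"
proof -
  have "inner (blinfun_apply (mean_periodogram M X T x) z) y = inner (blinfun_apply (mean_periodogram M X T x) y) z"
    unfolding inner_mean_periodogram_eq_expectation
    by (intro Bochner_Integration.integral_cong refl) (simp add: mult.commute)
  then show ?thesis by (simp only: inner_commute)
qed

lemma continuous_mean_periodogram: "continuous_on S (mean_periodogram M X T)"
  unfolding mean_periodogram_eq cis_conv_exp
  by (intro continuous_intros continuous_cscale_op)

lemma quadratic_autocov_minus: "quadratic_autocov M X z (- t) = cnj (quadratic_autocov M X z t)"
  by (simp only: quadratic_autocov_def cinner_complexify_autocov_minus)

lemma inner_mean_periodogram:
  "inner (blinfun_apply (mean_periodogram M X T x) z) z =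
    Re (toeplitz_form (quadratic_autocov M X z) T x) / (2 * pi * real T)"
  by (simp only: mean_periodogram_eq inner_eq_Re_cinner blinfun.scaleR_left blinfun.sum_left
    cscale_op_apply cinner_scaleR_left cinner_sum_left cinner_cscale_left toeplitz_form_def quadratic_autocov_def)
    (simp add: mult.commute)

lemma toeplitz_form_quadratic_autocov_nonneg: "0 \<le> Re (toeplitz_form (quadratic_autocov M X z) T x)"
proof (cases "T = 0")
  case False
  then show ?thesis
    using inner_mean_periodogram_nonneg[of T x z] pi_gt_zero
    by (simp add: inner_mean_periodogram zero_le_divide_iff mult_le_0_iff del: pi_gt_zero)
qed (simp add: toeplitz_form_def)

lemma integral_inner_mean_periodogram:
  assumes "T \<ge> 1"
  shows "((\<lambda>x. inner (blinfun_apply (mean_periodogram M X T x) z) z) has_integral Re (quadratic_autocov M X z 0)) {-pi..pi}"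
proof -
  have "((\<lambda>x. Re (toeplitz_form (quadratic_autocov M X z) T x)) has_integral (2 * pi * real T * Re (quadratic_autocov M X z 0))) {-pi..pi}"
    using has_integral_linear[OF integral_toeplitz_form[of 0 "quadratic_autocov M X z" T] bounded_linear_Re]
    by (simp add: o_def)
  from has_integral_divide[OF this, of "2 * pi * real T"] show ?thesis
    using assms by (simp add: inner_mean_periodogram)
qed

lemma spectral_density_inner_limit:
  assumes "is_spectral_density_at M X x A"
  shows "(\<lambda>n. 1 / (2 * pi) * (\<Sum>t\<in>{- int n..int n}. Re (cinner (blinfun_apply (complexify (autocov M X t)) z) y * cis (- (of_int t * x)))))
    \<longlonglongrightarrow> inner (blinfun_apply A z) y"
proof -
  have "(\<lambda>n. inner (blinfun_apply ((1 / (2 * pi)) *\<^sub>R (\<Sum>t\<in>{- int n..int n}.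
           cscale_op (exp (- (\<i> * of_real x * of_int t))) (complexify (autocov M X t)))) z) y)
     \<longlonglongrightarrow> inner (blinfun_apply A z) y"
    by (intro tendsto_intros assms[unfolded is_spectral_density_at_def])
  moreover have "exp (- (\<i> * of_real x * of_int t)) = cis (- (of_int t * x))" for t
    by (simp add: cis_conv_exp mult_ac)
  ultimately show ?thesis
    by (simp only: blinfun.scaleR_left inner_scaleR_left inner_sum_cscale_op mult.commute[of "cis _"])
qed

text \<open>
  The terms at lags \<open>t\<close> and \<open>-t\<close> are adjoint to each other, so each symmetric partial sum is
  self-adjoint.
\<close>

lemma spectral_density_commute:
  assumes "is_spectral_density_at M X x A"
  shows "inner (blinfun_apply A z) y = inner z (blinfun_apply A y)"
proof -
  have "(\<Sum>t\<in>{- int n..int n}. Re (cinner (blinfun_apply (complexify (autocov M X t)) z) y * cis (- (of_int t * x)))) =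
     (\<Sum>t\<in>{- int n..int n}. Re (cinner (blinfun_apply (complexify (autocov M X t)) y) z * cis (- (of_int t * x))))" for n
  proof (rule sum.reindex_bij_witness[of _ uminus uminus])
    fix t
    have "Re (cinner (blinfun_apply (complexify (autocov M X (- t))) y) z * cis (- (of_int (- t) * x))) =
       Re (cnj (cinner (blinfun_apply (complexify (autocov M X t)) z) y * cis (- (of_int t * x))))"
      by (simp only: cinner_complexify_autocov_minus complex_cnj_mult cis_cnj of_int_minus mult_minus_left)
    then show "Re (cinner (blinfun_apply (complexify (autocov M X (- t))) y) z * cis (- (of_int (- t) * x))) =
       Re (cinner (blinfun_apply (complexify (autocov M X t)) z) y * cis (- (of_int t * x)))"
      by (simp only: cnj.sel)
  qed auto
  then have "inner (blinfun_apply A z) y = inner (blinfun_apply A y) z"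
    using spectral_density_inner_limit[OF assms, of z y] spectral_density_inner_limit[OF assms, of y z]
    by (simp only: LIMSEQ_unique)
  then show ?thesis by (simp only: inner_commute)
qed

lemma integral_inner_spectral_density:
  assumes F: "\<And>x. x \<in> {-pi..pi} - {0} \<Longrightarrow> is_spectral_density_at M X x (F x)"
  shows "((\<lambda>x. inner (blinfun_apply (F x) z) z) has_integral Re (quadratic_autocov M X z 0)) {-pi..pi}"
proof -
  have "((\<lambda>x. 2 * pi * inner (blinfun_apply (F x) z) z) has_integral 2 * pi * Re (quadratic_autocov M X z 0)) {-pi..pi}"
  proof (rule positive_trigonometric_series_integral)
    show "quadratic_autocov M X z (- n) = cnj (quadratic_autocov M X z n)" for n
      by (rule quadratic_autocov_minus)
    show "0 \<le> Re (toeplitz_form (quadratic_autocov M X z) T x)" for T x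
      by (rule toeplitz_form_quadratic_autocov_nonneg)
    fix x :: real assume "x \<in> {-pi..pi} - {0}"
    from tendsto_mult_left[OF spectral_density_inner_limit[OF F[OF this], of z z], of "2 * pi"]
    show "(\<lambda>n. \<Sum>t\<in>{- int n..int n}. Re (quadratic_autocov M X z t * cis (- (of_int t * x))))
        \<longlonglongrightarrow> 2 * pi * inner (blinfun_apply (F x) z) z"
      by (simp add: quadratic_autocov_def)
  qed
  from has_integral_divide[OF this, of "2 * pi"] show ?thesis by simp
qed

lemma spectral_density_integrable:
  assumes F: "\<And>x. x \<in> {-pi..pi} - {0} \<Longrightarrow> is_spectral_density_at M X x (F x)"
    and fin: "(\<integral>\<^sup>+x\<in>{-pi..pi}. ennreal (norm (F x)) \<partial>lborel) < \<infinity>"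
  shows "F integrable_on {-pi..pi}"
proof (rule pointwise_limit_of_continuous_integrable_on[OF _ F[unfolded is_spectral_density_at_def] fin])
  show "continuous_on {-pi..pi} (\<lambda>x. (1 / (2 * pi)) *\<^sub>R (\<Sum>t\<in>{- int n..int n}.
           cscale_op (exp (- (\<i> * of_real x * of_int t))) (complexify (autocov M X t))))" for n
    by (intro continuous_intros continuous_cscale_op)
qed

text \<open>
  The gauge integral commutes with the bounded functionals \<open>D \<mapsto> \<langle>D z, y\<rangle>\<close>. On the diagonal they give
  \<open>\<langle>R\<^sub>0 z, z\<rangle>\<close> for both terms; off it they transfer self-adjointness from the integrand, known outside
  \<open>0\<close>, to the integral.
\<close>

lemma integral_spectral_density_minus_mean_periodogram:
  assumes F: "\<And>x. x \<in> {-pi..pi} - {0} \<Longrightarrow> is_spectral_density_at M X x (F x)"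
    and fin: "(\<integral>\<^sup>+x\<in>{-pi..pi}. ennreal (norm (F x)) \<partial>lborel) < \<infinity>"
    and T: "T \<ge> 1"
  shows "((\<lambda>x. F x - mean_periodogram M X T x) has_integral 0) {-pi..pi}"
proof -
  let ?G = "\<lambda>x. F x - mean_periodogram M X T x"
  have "?G integrable_on {-pi..pi}"
    by (intro integrable_diff spectral_density_integrable[OF F fin] integrable_continuous_real
      continuous_mean_periodogram)
  then have G: "(?G has_integral integral {-pi..pi} ?G) {-pi..pi}"
    by (rule integrable_integral)
  have inner_G: "((\<lambda>x. inner (blinfun_apply (?G x) z) y) has_integral
      inner (blinfun_apply (integral {-pi..pi} ?G) z) y) {-pi..pi}" for z y
    using has_integral_linear[OF G bounded_linear_compose[OF bounded_linear_inner_left[of y] blinfun.bounded_linear_left[of z]]]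
    by (simp add: o_def)
  have "integral {-pi..pi} ?G = 0"
  proof (rule symmetric_blinfun_eq_0)
    fix z y
    have "inner (blinfun_apply (?G x) z) y = inner (blinfun_apply (?G x) y) z" if "x \<in> {-pi..pi} - {0}" for x
      using spectral_density_commute[OF F[OF that], of z y] inner_mean_periodogram_commute[of T x z y]
      by (simp only: blinfun.diff_left inner_diff_left inner_commute[of z])
    then have "((\<lambda>x. inner (blinfun_apply (?G x) y) z) has_integral
        inner (blinfun_apply (integral {-pi..pi} ?G) z) y) {-pi..pi}"
      by (intro has_integral_spike_finite[OF _ _ inner_G, of "{0}"]) auto
    then show "inner (blinfun_apply (integral {-pi..pi} ?G) z) y = inner z (blinfun_apply (integral {-pi..pi} ?G) y)"
      using inner_G[of y z] by (simp only: has_integral_unique inner_commute[of z])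
  next
    fix z
    have "((\<lambda>x. inner (blinfun_apply (?G x) z) z) has_integral Re (quadratic_autocov M X z 0) - Re (quadratic_autocov M X z 0)) {-pi..pi}"
      unfolding blinfun.diff_left inner_diff_left
      by (intro has_integral_diff integral_inner_spectral_density F integral_inner_mean_periodogram[OF T])
    then show "inner (blinfun_apply (integral {-pi..pi} ?G) z) z = 0"
      using inner_G[of z z] by (simp add: has_integral_unique)
  qed
  with G show ?thesis by simp
qed

end

lemma hilbert_schmidt_0: "hilbert_schmidt 0"
  by (simp add: hilbert_schmidt_def)

lemma hs_norm_0: "hs_norm 0 = 0"
  by (simp add: hs_norm_def)

theorem theorem1:
  fixes M :: "'w measure"
    and X :: "int \<Rightarrow> 'w \<Rightarrow> 'h::{real_inner,banach,second_countable_topology}"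
    and F :: "real \<Rightarrow> 'h cop"
  assumes "prob_space M"
    and "\<And>t. X t \<in> borel_measurable M"
    and "strictly_stationary M X"
    and "integrable M (\<lambda>w. (norm (X 0 w))\<^sup>2)"
    and "\<And>t. (\<integral>w. X t w \<partial>M) = 0"
    and "\<And>\<omega>. \<omega> \<in> {-pi..pi} - {0} \<Longrightarrow> is_spectral_density_at M X \<omega> (F \<omega>)"
    and "(\<integral>\<^sup>+\<omega>\<in>{-pi..pi}. ennreal (norm (F \<omega>)) \<partial>lborel) < \<infinity>"
  shows "(\<forall>T\<ge>1. (\<lambda>\<omega>. F \<omega> - mean_periodogram M X T \<omega>) integrable_on {-pi..pi} \<and>
            hilbert_schmidt (integral {-pi..pi} (\<lambda>\<omega>. F \<omega> - mean_periodogram M X T \<omega>))) \<and>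
         (\<lambda>T. hs_norm (integral {-pi..pi} (\<lambda>\<omega>. F \<omega> - mean_periodogram M X T \<omega>)))
           \<longlonglongrightarrow> 0"
proof -
  have zero: "((\<lambda>\<omega>. F \<omega> - mean_periodogram M X T \<omega>) has_integral 0) {-pi..pi}" if "T \<ge> 1" for T
    by (rule integral_spectral_density_minus_mean_periodogram[OF assms(2,3,4,6,7) that])
  show ?thesis
  proof (intro conjI allI impI)
    fix T :: nat assume T: "T \<ge> 1"
    show "(\<lambda>\<omega>. F \<omega> - mean_periodogram M X T \<omega>) integrable_on {-pi..pi}"
      using zero[OF T] by blast
    show "hilbert_schmidt (integral {-pi..pi} (\<lambda>\<omega>. F \<omega> - mean_periodogram M X T \<omega>))"
      using integral_unique[OF zero[OF T]] by (simp add: hilbert_schmidt_0)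
  next
    have "\<forall>\<^sub>F T in sequentially. hs_norm (integral {-pi..pi} (\<lambda>\<omega>. F \<omega> - mean_periodogram M X T \<omega>)) = 0"
      using eventually_ge_at_top[of 1]
      by eventually_elim (simp add: integral_unique[OF zero] hs_norm_0)
    then show "(\<lambda>T. hs_norm (integral {-pi..pi} (\<lambda>\<omega>. F \<omega> - mean_periodogram M X T \<omega>))) \<longlonglongrightarrow> 0"
      by (rule tendsto_eventually)
  qed
qed

end
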